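(* The boundary control system is not spectrally controllable in $H^1_0(0,1)\times L^2(0,1)$: for every $T>0$ and every nonzero $U^0=(u_0,v_0)$ belonging to the linear span of finitely many eigenfunctions of $A$ (i.e. of finitely many elements of $\{U_0\}\cup\{U_n:n\in\mathbb{Z}\setminus\{0\}\}$), there is no $h\in H^1(0,T)$ with $h(0)=0$ such that the solution $(u,v)$ of the boundary control system with initial data $(u_0,v_0)$ and control $h$ satisfies $u(\cdot,T)=0$ and $v(\cdot,T)=0$.
   Context: Complex-valued functions. $\mathcal{H}=H^1_0(0,1)\times L^2(0,1)$ with inner product $((u,v),(\varphi,\psi))_{\mathcal{H}}=\int_0^1(u'\overline{\varphi'}+u\overline\varphi)+\int_0^1v\overline\psi$. $(I-\partial_x^2)^{-1}$: inverse of $I-d^2/dx^2$ on $(0,1)$ with homogeneous Dirichlet conditions ($H^{-1}\to H^1_0$). $A(u,v)=(-(I-\partial_x^2)^{-1}\partial_xv,-\partial_xu)$ on $\mathcal{H}$. Its eigenfunctions: $U_0=(0,1)$ (eigenvalue $0$) and $U_n=(\frac{\sin(n\pi x)}{\sqrt{1+n^2\pi^2}},\,i\cos(n\pi x))$ with eigenvalue $\frac{in\pi}{\sqrt{1+n^2\pi^2}}$, $n\in\mathbb{Z}\setminus\{0\}$. Boundary control system: $\partial_tu-\partial_t\partial_x^2u-\partial_xv=0$, $\partial_tv-\partial_xu=0$ on $(0,1)\times(0,T)$, $u(0,t)=0$, $u(1,t)=h(t)$, $(u,v)(\cdot,0)=(u_0,v_0)$; its solution (for $h\in H^1(0,T)$,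 $u_0(1)=h(0)$) is $u=w+xh(t)$, $v=z$, where $W=(w,z)\in C([0,T];\mathcal{H})$, $W(t)=e^{-tA}W_0+\int_0^te^{-(t-\tau)A}F(\tau)d\tau$, $W_0=(u_0-xh(0),v_0)$, $F(t)=(-(I-\partial_x^2)^{-1}(x h'(t)),h(t))$. *)

theory Defs
  imports "HOL-Analysis.Analysis"
begin

text \<open>Complex-valued functions on the interval; only values on the interval matter.\<close>

definition L2_on :: "real \<Rightarrow> real \<Rightarrow> (real \<Rightarrow> complex) \<Rightarrow> bool" where
  "L2_on a b g \<longleftrightarrow> g \<in> borel_measurable (lebesgue_on {a..b}) \<and>
     integrable (lebesgue_on {a..b}) (\<lambda>x. (cmod (g x))^2)"

text \<open>H^1(a,b): (continuous representatives of) functions that are indefinite integrals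
  of an L^2 function (the weak derivative).\<close>
definition H1_on :: "real \<Rightarrow> real \<Rightarrow> (real \<Rightarrow> complex) \<Rightarrow> bool" where
  "H1_on a b u \<longleftrightarrow> (\<exists>g. L2_on a b g \<and>
     (\<forall>x\<in>{a..b}. u x = u a + integral\<^sup>L (lebesgue_on {a..x}) g))"

definition wderiv_on :: "real \<Rightarrow> real \<Rightarrow> (real \<Rightarrow> complex) \<Rightarrow> (real \<Rightarrow> complex)" where
  "wderiv_on a b u = (SOME g. L2_on a b g \<and>
     (\<forall>x\<in>{a..b}. u x = u a + integral\<^sup>L (lebesgue_on {a..x}) g))"

abbreviation L2 :: "(real \<Rightarrow> complex) \<Rightarrow> bool" where "L2 \<equiv> L2_on 0 1"
abbreviation wderiv :: "(real \<Rightarrow> complex) \<Rightarrow> (real \<Rightarrow> complex)" where "wderiv \<equiv> wderiv_on 0 1"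

definition H10 :: "(real \<Rightarrow> complex) \<Rightarrow> bool" where
  "H10 u \<longleftrightarrow> H1_on 0 1 u \<and> u 0 = 0 \<and> u 1 = 0"

definition ipL2 :: "(real \<Rightarrow> complex) \<Rightarrow> (real \<Rightarrow> complex) \<Rightarrow> complex" where
  "ipL2 f g = integral\<^sup>L (lebesgue_on {0..1}) (\<lambda>x. f x * cnj (g x))"

definition ipH1 :: "(real \<Rightarrow> complex) \<Rightarrow> (real \<Rightarrow> complex) \<Rightarrow> complex" where
  "ipH1 u \<phi> = ipL2 (wderiv u) (wderiv \<phi>) + ipL2 u \<phi>"

type_synonym state = "(real \<Rightarrow> complex) \<times> (real \<Rightarrow> complex)"

definition Hspace :: "state set" where
  "Hspace = {(u, v). H10 u \<and> L2 v}"

definition ipH :: "state \<Rightarrow> state \<Rightarrow> complex" where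
  "ipH U \<Phi> = ipH1 (fst U) (fst \<Phi>) + ipL2 (snd U) (snd \<Phi>)"

text \<open>Elements of H^{-1} are represented as (antilinear) functionals on H^1_0.\<close>
definition embL2 :: "(real \<Rightarrow> complex) \<Rightarrow> ((real \<Rightarrow> complex) \<Rightarrow> complex)" where
  "embL2 f = (\<lambda>\<phi>. ipL2 f \<phi>)"

text \<open>Distributional derivative of an L^2 function, as element of H^{-1}.\<close>
definition dx_dual :: "(real \<Rightarrow> complex) \<Rightarrow> ((real \<Rightarrow> complex) \<Rightarrow> complex)" where
  "dx_dual v = (\<lambda>\<phi>. - ipL2 v (wderiv \<phi>))"

text \<open>(I - d^2/dx^2)^{-1} with Dirichlet conditions, H^{-1} to H^1_0 (weak formulation).\<close>
definition resolvent :: "((real \<Rightarrow> complex) \<Rightarrow> complex) \<Rightarrow> (real \<Rightarrow> complex)" where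
  "resolvent L = (SOME w. H10 w \<and> (\<forall>\<phi>. H10 \<phi> \<longrightarrow> ipH1 w \<phi> = L \<phi>))"

definition opA :: "state \<Rightarrow> state" where
  "opA U = ((\<lambda>x. - resolvent (dx_dual (snd U)) x), (\<lambda>x. - wderiv (fst U) x))"

definition eigU :: "int \<Rightarrow> state" where
  "eigU n = (if n = 0 then ((\<lambda>x. 0), (\<lambda>x. 1))
     else ((\<lambda>x. complex_of_real (sin (real_of_int n * pi * x) / sqrt (1 + (real_of_int n * pi)^2))),
           (\<lambda>x. \<i> * complex_of_real (cos (real_of_int n * pi * x)))))"

text \<open>(e^{-sA} X, \<Phi>)_H, with e^{-sA} the exponential series of the bounded operator A.\<close>
definition semigrp_ip :: "real \<Rightarrow> state \<Rightarrow> state \<Rightarrow> complex" where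
  "semigrp_ip s X \<Phi> = (\<Sum>k. complex_of_real ((- s) ^ k / fact k) * ipH ((opA ^^ k) X) \<Phi>)"

definition forcing :: "real \<Rightarrow> (real \<Rightarrow> complex) \<Rightarrow> real \<Rightarrow> state" where
  "forcing T h t = ((\<lambda>x. - resolvent (embL2 (\<lambda>y. complex_of_real y * wderiv_on 0 T h t)) x),
                    (\<lambda>x. h t))"

text \<open>W solves W(t) = e^{-tA} W0 + int_0^t e^{-(t-\<tau>)A} F(\<tau>) d\<tau> in H for t in [0,T]
  (identity in H, tested against all elements of H).\<close>
definition is_solution :: "real \<Rightarrow> (real \<Rightarrow> complex) \<Rightarrow> (real \<Rightarrow> complex) \<Rightarrow> (real \<Rightarrow> complex)
    \<Rightarrow> (real \<Rightarrow> state) \<Rightarrow> bool" where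
  "is_solution T h u0 v0 W \<longleftrightarrow>
     (\<forall>t\<in>{0..T}. W t \<in> Hspace \<and>
        (\<forall>\<Phi>\<in>Hspace. ipH (W t) \<Phi> =
            semigrp_ip t ((\<lambda>x. u0 x - complex_of_real x * h 0), v0) \<Phi>
            + integral {0..t} (\<lambda>\<tau>. semigrp_ip (t - \<tau>) (forcing T h \<tau>) \<Phi>)))"

end

theory Submission
  imports Defs "HOL-Complex_Analysis.Complex_Analysis" "HOL-Real_Asymp.Real_Asymp"
begin

text \<open>
  Testing the Duhamel formula at time \<open>T\<close> against \<open>U\<^sub>n\<close> diagonalises the semigroup. If the control
  \<open>h\<close> steers the initial state to zero, then \<open>h(T) = 0\<close>, and after an integration by parts the
  coordinate of the initial state along \<open>U\<^sub>n\<close> is a nonzero multiple of \<open>H(\<lambda>\<^sub>n)\<close>, where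
  \<open>H(z) = \<integral>\<^sub>0\<^sup>T h(t) e\<^sup>z\<^sup>t dt\<close> is entire and \<open>\<lambda>\<^sub>n\<close> is the eigenvalue. An initial state in the span
  of finitely many eigenfunctions has only finitely many nonzero coordinates, so \<open>H(\<lambda>\<^sub>n) = 0\<close> for
  all large \<open>n\<close>. Since \<open>A\<close> is bounded, its eigenvalues accumulate, at \<open>\<i>\<close>; hence \<open>H\<close> vanishes
  identically, and all coordinates of the initial state are zero.
\<close>

section \<open>Weak derivatives on an interval\<close>

text \<open>Moving the variable endpoint into an indicator leaves one fixed measure on
  \<open>{a..b}\<close>, as Fubini and the measure-theoretic uniqueness argument below
  require.\<close>

lemma integral_lebesgue_on_subinterval:
  fixes g :: "real \<Rightarrow> 'a::{banach, second_countable_topology}"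
  assumes "x \<le> b"
  shows "integral\<^sup>L (lebesgue_on {a..x}) g = integral\<^sup>L (lebesgue_on {a..b}) (\<lambda>s. indicat_real {..x} s *\<^sub>R g s)"
proof -
  have *: "indicat_real {a..b} s * indicat_real {..x} s = indicat_real {a..x} s" for s
    using assms by (auto simp: indicator_def)
  show ?thesis
    by (simp add: integral_restrict_space *)
qed

text \<open>A relation rather than the choice made by \<open>wderiv_on\<close>, so that explicit
  derivatives can be supplied. Only integrability is demanded, which suffices for integration by
  parts; square integrability is added separately to obtain \<open>H1_on\<close>.\<close>

definition weak_derivative_on :: "real \<Rightarrow> real \<Rightarrow> (real \<Rightarrow> complex) \<Rightarrow> (real \<Rightarrow> complex) \<Rightarrow> bool" where
  "weak_derivative_on a b u g \<longleftrightarrow> integrable (lebesgue_on {a..b}) g \<and>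
     (\<forall>x\<in>{a..b}. u x = u a + integral\<^sup>L (lebesgue_on {a..x}) g)"

lemma finite_measure_lebesgue_on_Icc: "finite_measure (lebesgue_on {a..b::real})"
  by (intro finite_measure_lebesgue_on) auto

lemma integrable_mult_continuous:
  fixes g f :: "real \<Rightarrow> complex"
  assumes g: "integrable (lebesgue_on {a..b}) g" and f: "continuous_on {a..b} f"
  shows "integrable (lebesgue_on {a..b}) (\<lambda>x. g x * f x)"
proof -
  have "bounded (f ` {a..b})"
    using f compact_continuous_image compact_imp_bounded by blast
  then obtain B where B: "\<forall>x \<in> {a..b}. norm (f x) \<le> B"
    unfolding bounded_iff by blast
  have fm: "f \<in> borel_measurable (lebesgue_on {a..b})"
    using continuous_imp_measurable_on_sets_lebesgue[OF f] by auto
  show ?thesis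
  proof (rule Bochner_Integration.integrable_bound)
    show "integrable (lebesgue_on {a..b}) (\<lambda>x. B * norm (g x))"
      using g by auto
    show "(\<lambda>x. g x * f x) \<in> borel_measurable (lebesgue_on {a..b})"
      using g fm by (auto dest: borel_measurable_integrable)
    show "AE x in lebesgue_on {a..b}. norm (g x * f x) \<le> norm (B * norm (g x))"
    proof (rule AE_I2)
      fix x assume "x \<in> space (lebesgue_on {a..b})"
      then have "norm (f x) \<le> B" using B by auto
      then have "norm (g x * f x) \<le> B * norm (g x)"
        by (simp add: norm_mult mult.commute[of _ "norm (g x)"] mult_left_mono)
      then show "norm (g x * f x) \<le> norm (B * norm (g x))"
        by simp
    qed
  qed
qed

lemma weak_derivative_continuous:
  assumes "weak_derivative_on a b u g"
  shows "continuous_on {a..b} u"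
proof -
  have "continuous_on {a..b} (\<lambda>x. u a + integral\<^sup>L (lebesgue_on {a..x}) g)"
    using assms unfolding weak_derivative_on_def
    by (intro continuous_intros indefinite_integral_continuous_real) blast
  then show ?thesis
    by (rule continuous_on_eq) (use assms in \<open>metis weak_derivative_on_def\<close>)
qed

lemma FTC_lebesgue_on:
  fixes f f' :: "real \<Rightarrow> complex"
  assumes "a \<le> b"
    and "\<And>x. x \<in> {a..b} \<Longrightarrow> (f has_vector_derivative f' x) (at x within {a..b})"
    and "continuous_on {a..b} f'"
  shows "integral\<^sup>L (lebesgue_on {a..b}) f' = f b - f a"
proof -
  have "integrable (lebesgue_on {a..b}) f'"
    using continuous_imp_integrable_real assms(3) by blast
  then have "integral\<^sup>L (lebesgue_on {a..b}) f' = integral {a..b} f'"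
    by (rule lebesgue_integral_eq_integral) auto
  also have "\<dots> = f b - f a"
    using fundamental_theorem_of_calculus[OF assms(1,2)] by blast
  finally show ?thesis .
qed

text \<open>Since \<open>u\<close> is known only as an indefinite integral, the formula comes from
  Fubini: \<open>f' x * g s\<close> is integrated over the triangle s \<le> x in both
  orders.\<close>

lemma weak_derivative_by_parts:
  assumes ab: "a \<le> b" and u: "weak_derivative_on a b u g"
    and f: "\<And>x. x \<in> {a..b} \<Longrightarrow> (f has_vector_derivative f' x) (at x within {a..b})"
    and f': "continuous_on {a..b} f'"
  shows "integral\<^sup>L (lebesgue_on {a..b}) (\<lambda>x. g x * f x) =
    u b * f b - u a * f a - integral\<^sup>L (lebesgue_on {a..b}) (\<lambda>x. u x * f' x)"
proof -
  let ?M = "lebesgue_on {a..b}"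
  interpret M: finite_measure ?M by (rule finite_measure_lebesgue_on_Icc)
  interpret P: pair_sigma_finite ?M ?M by unfold_locales
  have g: "integrable ?M g" using u by (simp add: weak_derivative_on_def)
  have uint: "integral\<^sup>L (lebesgue_on {a..x}) g = u x - u a" if "x \<in> {a..b}" for x
    using u that unfolding weak_derivative_on_def by (metis add_diff_cancel_left')
  have f'i: "integrable ?M f'" using continuous_imp_integrable_real f' by blast
  have gm [measurable]: "g \<in> borel_measurable ?M" and fm [measurable]: "f' \<in> borel_measurable ?M"
    using g f'i by (auto dest: borel_measurable_integrable)
  have id [measurable]: "(\<lambda>x. x) \<in> borel_measurable ?M"
    using id_borel_measurable_lebesgue_on unfolding id_def .
  have fcont: "continuous_on {a..b} f"
    using f by (meson continuous_on_eq_continuous_within has_vector_derivative_continuous)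
  \<comment> \<open>The kernel restricted to s \<le> x. Integrating in s first produces
    \<open>f' x * (u x - u a)\<close>, integrating in x first produces
    \<open>g s * (f b - f s)\<close>. Its norm is bounded by that of the integrable product
    \<open>f' x * g s\<close>.\<close>
  define k where "k = (\<lambda>x s. indicat_real {..x} s *\<^sub>R (f' x * g s))"
  have km: "(\<lambda>(x, s). k x s) \<in> borel_measurable (?M \<Otimes>\<^sub>M ?M)"
    unfolding k_def indicator_def by simp
  have prod: "integrable (?M \<Otimes>\<^sub>M ?M) (\<lambda>(x, s). f' x * g s)"
    by (rule P.Fubini_integrable) (use f'i g in \<open>auto simp: norm_mult\<close>)
  have k: "integrable (?M \<Otimes>\<^sub>M ?M) (\<lambda>(x, s). k x s)"
    by (rule Bochner_Integration.integrable_bound[OF prod km])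
       (auto simp: k_def indicator_def)
  have swap: "(\<integral>s. (\<integral>x. k x s \<partial>?M) \<partial>?M) = (\<integral>x. (\<integral>s. k x s \<partial>?M) \<partial>?M)"
    by (rule P.Fubini_integral[OF k])
  have "(\<integral>x. (\<integral>s. k x s \<partial>?M) \<partial>?M) = (\<integral>x. u x * f' x - u a * f' x \<partial>?M)"
  proof (intro Bochner_Integration.integral_cong refl)
    fix x assume "x \<in> space ?M"
    then have x: "x \<in> {a..b}" by simp
    have "(\<integral>s. k x s \<partial>?M) = (\<integral>s. f' x * (indicat_real {..x} s *\<^sub>R g s) \<partial>?M)"
      by (simp add: k_def)
    also have "\<dots> = f' x * integral\<^sup>L (lebesgue_on {a..x}) g"
      using x integral_lebesgue_on_subinterval[of x b a g] by (simp only: integral_mult_right_zero) simp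
    also have "\<dots> = f' x * (u x - u a)"
      using uint[OF x] by simp
    finally show "(\<integral>s. k x s \<partial>?M) = u x * f' x - u a * f' x" by (simp add: algebra_simps)
  qed
  also have "\<dots> = (\<integral>x. u x * f' x \<partial>?M) - u a * (f b - f a)"
    using weak_derivative_continuous[OF u] f'i f' FTC_lebesgue_on[OF ab f f']
    by (subst Bochner_Integration.integral_diff)
       (auto intro!: continuous_imp_integrable_real continuous_intros)
  finally have 1: "(\<integral>x. (\<integral>s. k x s \<partial>?M) \<partial>?M) = (\<integral>x. u x * f' x \<partial>?M) - u a * (f b - f a)" .
  have "(\<integral>s. (\<integral>x. k x s \<partial>?M) \<partial>?M) = (\<integral>s. g s * f b - g s * f s \<partial>?M)"
  proof (intro Bochner_Integration.integral_cong refl)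
    fix s assume "s \<in> space ?M"
    then have s: "s \<in> {a..b}" by simp
    have *: "indicat_real {a..b} x * indicat_real {..x} s = indicat_real {s..b} x" for x
      using s by (auto simp: indicator_def)
    have "(\<integral>x. k x s \<partial>?M) = (\<integral>x. g s * (indicat_real {..x} s *\<^sub>R f' x) \<partial>?M)"
      by (simp add: k_def mult.commute)
    also have "\<dots> = g s * (\<integral>x. indicat_real {..x} s *\<^sub>R f' x \<partial>?M)"
      by (rule integral_mult_right_zero)
    also have "(\<integral>x. indicat_real {..x} s *\<^sub>R f' x \<partial>?M) = integral\<^sup>L (lebesgue_on {s..b}) f'"
      by (simp add: integral_restrict_space *)
    also have "\<dots> = f b - f s"
    proof (rule FTC_lebesgue_on)
      show "continuous_on {s..b} f'" using s by (auto intro: continuous_on_subset[OF f'])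
      show "(f has_vector_derivative f' x) (at x within {s..b})" if "x \<in> {s..b}" for x
        using s that by (intro has_vector_derivative_within_subset[OF f]) auto
    qed (use s in auto)
    finally show "(\<integral>x. k x s \<partial>?M) = g s * f b - g s * f s" by (simp add: algebra_simps)
  qed
  also have "\<dots> = (u b - u a) * f b - (\<integral>s. g s * f s \<partial>?M)"
    using g fcont ab
    by (subst Bochner_Integration.integral_diff)
       (auto intro!: integrable_mult_continuous simp: uint)
  finally have 2: "(\<integral>s. (\<integral>x. k x s \<partial>?M) \<partial>?M) = (u b - u a) * f b - (\<integral>s. g s * f s \<partial>?M)" .
  have "(\<integral>x. u x * f' x \<partial>?M) - u a * (f b - f a) = (u b - u a) * f b - (\<integral>s. g s * f s \<partial>?M)"
    using 1 2 swap by (simp only:)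
  then show ?thesis by (simp add: algebra_simps)
qed

text \<open>A Dynkin argument: the half-lines \<open>{..x}\<close> are stable under intersection and
  generate the Borel sets, so the integral of \<open>g\<close> vanishes over every Borel part of the
  interval, then over every Lebesgue part, which forces \<open>g\<close> to vanish almost
  everywhere.\<close>

lemma indefinite_integral_zero_imp_AE_zero:
  fixes g :: "real \<Rightarrow> complex"
  assumes ab: "a \<le> b" and g: "integrable (lebesgue_on {a..b}) g"
    and z: "\<And>x. x \<in> {a..b} \<Longrightarrow> integral\<^sup>L (lebesgue_on {a..x}) g = 0"
  shows "AE x in lebesgue_on {a..b}. g x = 0"
proof -
  let ?M = "lebesgue_on {a..b}"
  let ?I = "\<lambda>A. set_lebesgue_integral ?M A g"
  interpret M: finite_measure ?M by (rule finite_measure_lebesgue_on_Icc)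
  have sb: "{a..b} \<inter> A \<in> sets ?M" if "A \<in> sets borel" for A
    using that by (auto simp: sets_restrict_space)
  have total: "integral\<^sup>L ?M g = 0" using z[of b] ab by simp
  \<comment> \<open>The whole interval has integral 0; this drives the complement case of the
    induction and the half-lines with x > b.\<close>
  have total': "?I {a..b} = 0"
    using total unfolding set_lebesgue_integral_def
    by (subst Bochner_Integration.integral_cong[where g=g]) auto
  have si: "set_integrable ?M A g" if "A \<in> sets ?M" for A
    unfolding set_integrable_def using that g by (rule integrable_mult_indicator)
  have borel0: "?I ({a..b} \<inter> A) = 0" if "A \<in> sets borel" for A
  proof -
    have "A \<in> sigma_sets UNIV (range atMost)"
      using that by (simp add: borel_eq_atMost)
    with _ _ show ?thesis
    proof (rule sigma_sets_induct_disjoint)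
      show "Int_stable (range (atMost :: real \<Rightarrow> _))"
        by (auto simp: Int_stable_def)
      fix A :: "real set" assume "A \<in> range atMost"
      then obtain x where [simp]: "A = {..x}" by auto
      show "?I ({a..b} \<inter> A) = 0"
      proof (cases "x \<in> {a..b}")
        case True
        then have "?I ({a..b} \<inter> A) = (\<integral>s. indicat_real {..x} s *\<^sub>R g s \<partial>?M)"
          unfolding set_lebesgue_integral_def
          by (intro Bochner_Integration.integral_cong refl) (auto simp: indicator_def)
        then show ?thesis
          using z[OF True] True integral_lebesgue_on_subinterval[of x b a g] by simp
      next
        case False
        then consider "x < a" | "b < x" by force
        then show ?thesis
        proof cases
          case 1
          then have "{a..b} \<inter> A = {}" by auto
          then show ?thesis by (simp add: set_lebesgue_integral_def)
        next
          case 2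
          then have "{a..b} \<inter> A = {a..b}" by auto
          then show ?thesis using total' by (simp only:)
        qed
      qed
    next
      fix A :: "real set" assume A: "A \<in> sigma_sets UNIV (range atMost)" and 0: "?I ({a..b} \<inter> A) = 0"
      have Ab: "A \<in> sets borel" using A by (simp add: borel_eq_atMost)
      have "?I (({a..b} \<inter> A) \<union> ({a..b} \<inter> (UNIV - A))) = ?I ({a..b} \<inter> A) + ?I ({a..b} \<inter> (UNIV - A))"
        using Ab by (intro set_integral_Un si sb) auto
      moreover have "({a..b} \<inter> A) \<union> ({a..b} \<inter> (UNIV - A)) = {a..b}" by auto
      ultimately show "?I ({a..b} \<inter> (UNIV - A)) = 0" using total' 0 by simp
    next
      fix A :: "nat \<Rightarrow> real set"
      assume d: "disjoint_family A" and A: "range A \<subseteq> sigma_sets UNIV (range atMost)" and 0: "\<And>i. ?I ({a..b} \<inter> A i) = 0"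
      have Ab: "A i \<in> sets borel" for i using A by (auto simp: borel_eq_atMost)
      have "?I (\<Union>i. {a..b} \<inter> A i) = (\<Sum>i. ?I ({a..b} \<inter> A i))"
        using d Ab by (intro lebesgue_integral_countable_add si sb sets.countable_UN)
          (auto simp: disjoint_family_on_def intro: sb)
      then show "?I ({a..b} \<inter> \<Union> (range A)) = 0"
        using 0 by simp
    qed (auto simp: set_lebesgue_integral_def)
  qed
  show ?thesis
  proof (rule M.density_zero[OF g])
    fix A assume AM: "A \<in> sets ?M"
    then have A: "A \<in> sets lebesgue" by (auto simp: sets_restrict_space)
    \<comment> \<open>The induction reaches Borel sets only, whereas \<open>density_zero\<close>
      asks about Lebesgue sets; the Borel main part differs from \<open>A\<close> by a null
      set.\<close>
    let ?B = "main_part lborel A"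
    have B: "?B \<in> sets borel" using main_part_sets[OF A] by simp
    have "AE x in lebesgue. (x \<in> ?B) = (x \<in> A)"
      using AE_completion[OF AE_in_main_part[OF A]] .
    then have *: "AE x in ?M. (x \<in> ?B) = (x \<in> A)"
      by (subst AE_restrict_space_iff) auto
    have "?I A = ?I ({a..b} \<inter> ?B)"
      unfolding set_lebesgue_integral_def
    proof (rule integral_cong_AE)
      show "AE x in ?M. indicat_real A x *\<^sub>R g x = indicat_real ({a..b} \<inter> ?B) x *\<^sub>R g x"
        using * AE_space by eventually_elim (auto simp: indicator_def)
    qed (use si[OF AM] si[OF sb[OF B]] in \<open>auto simp: set_integrable_def dest: borel_measurable_integrable\<close>)
    then show "?I A = 0"
      using borel0[OF B] by simp
  qed
qed

section \<open>Calculus of weak derivatives\<close>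

lemma weak_derivative_cong:
  assumes "weak_derivative_on a b u g" "a \<le> b"
    and "\<And>x. x \<in> {a..b} \<Longrightarrow> u x = u' x" "\<And>x. x \<in> {a..b} \<Longrightarrow> g x = g' x"
  shows "weak_derivative_on a b u' g'"
  unfolding weak_derivative_on_def
proof safe
  show "integrable (lebesgue_on {a..b}) g'"
    using assms(1,4) unfolding weak_derivative_on_def
    by (subst Bochner_Integration.integrable_cong[where g=g]) auto
  fix x assume x: "x \<in> {a..b}"
  have "integral\<^sup>L (lebesgue_on {a..x}) g' = integral\<^sup>L (lebesgue_on {a..x}) g"
    using x assms(4) by (intro Bochner_Integration.integral_cong) auto
  moreover have "u x = u a + integral\<^sup>L (lebesgue_on {a..x}) g"
    using assms(1) x by (simp only: weak_derivative_on_def)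
  ultimately show "u' x = u' a + integral\<^sup>L (lebesgue_on {a..x}) g'"
    using assms(2,3) x by auto
qed

lemma weak_derivative_integrable:
  "weak_derivative_on a b u g \<Longrightarrow> integrable (lebesgue_on {a..b}) g"
  by (simp only: weak_derivative_on_def)

lemma weak_derivative_eq:
  "weak_derivative_on a b u g \<Longrightarrow> x \<in> {a..b} \<Longrightarrow> u x = u a + integral\<^sup>L (lebesgue_on {a..x}) g"
  by (simp only: weak_derivative_on_def)

lemma weak_derivativeI:
  assumes "integrable (lebesgue_on {a..b}) g"
    "\<And>x. x \<in> {a..b} \<Longrightarrow> u x = u a + integral\<^sup>L (lebesgue_on {a..x}) g"
  shows "weak_derivative_on a b u g"
  using assms by (simp only: weak_derivative_on_def) blast

lemma weak_derivative_subinterval: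
  assumes "weak_derivative_on a b u g" "c \<le> b"
  shows "weak_derivative_on a c u g"
proof (rule weak_derivativeI)
  show "integrable (lebesgue_on {a..c}) g"
    by (rule integrable_subinterval[OF weak_derivative_integrable[OF assms(1)]]) (use assms(2) in auto)
qed (rule weak_derivative_eq[OF assms(1)], use assms(2) in auto)

lemma weak_derivative_add:
  assumes u: "weak_derivative_on a b u g" and v: "weak_derivative_on a b v k"
  shows "weak_derivative_on a b (\<lambda>x. u x + v x) (\<lambda>x. g x + k x)"
proof (rule weak_derivativeI)
  show "integrable (lebesgue_on {a..b}) (\<lambda>x. g x + k x)"
    using weak_derivative_integrable[OF u] weak_derivative_integrable[OF v] by simp
  fix x assume x: "x \<in> {a..b}"
  have "integrable (lebesgue_on {a..x}) g" "integrable (lebesgue_on {a..x}) k"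
    using x by (auto intro!: weak_derivative_integrable[OF weak_derivative_subinterval[OF u]]
        weak_derivative_integrable[OF weak_derivative_subinterval[OF v]])
  then have "(\<integral>x. g x + k x \<partial>lebesgue_on {a..x}) = integral\<^sup>L (lebesgue_on {a..x}) g + integral\<^sup>L (lebesgue_on {a..x}) k"
    by simp
  then show "u x + v x = u a + v a + (\<integral>x. g x + k x \<partial>lebesgue_on {a..x})"
    by (subst weak_derivative_eq[OF u x], subst weak_derivative_eq[OF v x]) (simp only: ac_simps)
qed

lemma weak_derivative_cmult:
  assumes u: "weak_derivative_on a b u g"
  shows "weak_derivative_on a b (\<lambda>x. c * u x) (\<lambda>x. c * g x)"
proof (rule weak_derivativeI)
  show "integrable (lebesgue_on {a..b}) (\<lambda>x. c * g x)"
    using weak_derivative_integrable[OF u] by simp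
  fix x assume x: "x \<in> {a..b}"
  show "c * u x = c * u a + (\<integral>x. c * g x \<partial>lebesgue_on {a..x})"
    by (subst weak_derivative_eq[OF u x]) (simp add: algebra_simps)
qed

lemma weak_derivative_cnj:
  assumes u: "weak_derivative_on a b u g"
  shows "weak_derivative_on a b (\<lambda>x. cnj (u x)) (\<lambda>x. cnj (g x))"
proof (rule weak_derivativeI)
  show "integrable (lebesgue_on {a..b}) (\<lambda>x. cnj (g x))"
    using weak_derivative_integrable[OF u] by simp
  fix x assume x: "x \<in> {a..b}"
  show "cnj (u x) = cnj (u a) + (\<integral>x. cnj (g x) \<partial>lebesgue_on {a..x})"
    by (subst weak_derivative_eq[OF u x]) simp
qed

lemma weak_derivative_C1:
  fixes f f' :: "real \<Rightarrow> complex"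
  assumes f: "\<And>x. x \<in> {a..b} \<Longrightarrow> (f has_vector_derivative f' x) (at x within {a..b})"
    and f': "continuous_on {a..b} f'"
  shows "weak_derivative_on a b f f'"
proof (rule weak_derivativeI)
  show "integrable (lebesgue_on {a..b}) f'"
    using continuous_imp_integrable_real f' by blast
  fix x assume x: "x \<in> {a..b}"
  have "integral\<^sup>L (lebesgue_on {a..x}) f' = f x - f a"
  proof (rule FTC_lebesgue_on)
    show "continuous_on {a..x} f'" using x by (auto intro: continuous_on_subset[OF f'])
    show "(f has_vector_derivative f' s) (at s within {a..x})" if "s \<in> {a..x}" for s
      using x that by (intro has_vector_derivative_within_subset[OF f]) auto
  qed (use x in auto)
  then show "f x = f a + integral\<^sup>L (lebesgue_on {a..x}) f'" by simp
qed

text \<open>The fundamental theorem of calculus for a continuous integrand upgrades a weak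
  derivative to a classical one, so that such a \<open>u\<close> may serve as the smooth factor in
  integration by parts.\<close>

lemma weak_derivative_continuous_imp_C1:
  assumes u: "weak_derivative_on a b u g" and g: "continuous_on {a..b} g" and x: "x \<in> {a..b}"
  shows "(u has_vector_derivative g x) (at x within {a..b})"
proof -
  have "((\<lambda>x. integral {a..x} g) has_vector_derivative g x) (at x within {a..b})"
    using g x by (rule integral_has_vector_derivative)
  then have "((\<lambda>x. u a + integral {a..x} g) has_vector_derivative g x) (at x within {a..b})"
    by (auto intro!: derivative_eq_intros)
  then show ?thesis
  proof (rule has_vector_derivative_transform[OF x, rotated])
    fix y assume y: "y \<in> {a..b}"
    have "integrable (lebesgue_on {a..y}) g"
      by (rule integrable_subinterval[OF weak_derivative_integrable[OF u]]) (use y in auto)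
    then show "u y = u a + integral {a..y} g"
      by (subst weak_derivative_eq[OF u y]) (simp add: lebesgue_integral_eq_integral)
  qed
qed

text \<open>Integration by parts on each subinterval \<open>{a..x}\<close> is exactly the product
  rule in integrated form.\<close>

lemma weak_derivative_mult_C1:
  assumes u: "weak_derivative_on a b u g"
    and f: "\<And>x. x \<in> {a..b} \<Longrightarrow> (f has_vector_derivative f' x) (at x within {a..b})"
    and f': "continuous_on {a..b} f'"
  shows "weak_derivative_on a b (\<lambda>x. u x * f x) (\<lambda>x. g x * f x + u x * f' x)"
proof (rule weak_derivativeI)
  have fc: "continuous_on {a..b} f"
    using f by (meson continuous_on_eq_continuous_within has_vector_derivative_continuous)
  have gf: "integrable (lebesgue_on {a..b}) (\<lambda>x. g x * f x)"
    by (rule integrable_mult_continuous[OF weak_derivative_integrable[OF u] fc])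
  have uf: "integrable (lebesgue_on {a..b}) (\<lambda>x. u x * f' x)"
    using weak_derivative_continuous[OF u] f' by (intro continuous_imp_integrable_real continuous_intros)
  show "integrable (lebesgue_on {a..b}) (\<lambda>x. g x * f x + u x * f' x)"
    using gf uf by simp
  fix x assume x: "x \<in> {a..b}"
  have 1: "integrable (lebesgue_on {a..x}) (\<lambda>x. g x * f x)" "integrable (lebesgue_on {a..x}) (\<lambda>x. u x * f' x)"
    using integrable_subinterval[OF gf] integrable_subinterval[OF uf] x by auto
  have "(\<integral>s. g s * f s \<partial>lebesgue_on {a..x}) = u x * f x - u a * f a - (\<integral>s. u s * f' s \<partial>lebesgue_on {a..x})"
  proof (rule weak_derivative_by_parts)
    show "weak_derivative_on a x u g" using x by (intro weak_derivative_subinterval[OF u]) auto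
    show "continuous_on {a..x} f'" using x by (auto intro: continuous_on_subset[OF f'])
    show "(f has_vector_derivative f' s) (at s within {a..x})" if "s \<in> {a..x}" for s
      using x that by (intro has_vector_derivative_within_subset[OF f]) auto
  qed (use x in auto)
  then show "u x * f x = u a * f a + (\<integral>x. g x * f x + u x * f' x \<partial>lebesgue_on {a..x})"
    using 1 by simp
qed

section \<open>Square-integrable functions and the space H^1\<close>

lemma L2_on_imp_integrable:
  assumes "L2_on a b g"
  shows "integrable (lebesgue_on {a..b}) g"
proof -
  interpret M: finite_measure "lebesgue_on {a..b}" by (rule finite_measure_lebesgue_on_Icc)
  show ?thesis
  proof (rule Bochner_Integration.integrable_bound)
    show "integrable (lebesgue_on {a..b}) (\<lambda>x. 1 + (cmod (g x))^2)"
      using assms by (auto simp: L2_on_def)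
    have "r \<le> 1 + r^2" for r :: real
      using zero_le_power2[of "r - 1/2"] by (simp add: power2_eq_square algebra_simps)
    then show "AE x in lebesgue_on {a..b}. norm (g x) \<le> norm (1 + (cmod (g x))^2)"
      by (auto simp: abs_of_nonneg)
  qed (use assms in \<open>auto simp: L2_on_def\<close>)
qed

lemma L2_on_continuous:
  assumes "continuous_on {a..b} g"
  shows "L2_on a b g"
  unfolding L2_on_def using continuous_imp_measurable_on_sets_lebesgue[OF assms] assms
  by (auto intro!: continuous_imp_integrable_real continuous_intros)

lemma L2_on_add:
  assumes f: "L2_on a b f" and g: "L2_on a b g"
  shows "L2_on a b (\<lambda>x. f x + g x)"
  unfolding L2_on_def
proof
  have [measurable]: "f \<in> borel_measurable (lebesgue_on {a..b})" "g \<in> borel_measurable (lebesgue_on {a..b})"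
    using f g by (auto simp: L2_on_def)
  show "(\<lambda>x. f x + g x) \<in> borel_measurable (lebesgue_on {a..b})" by measurable
  show "integrable (lebesgue_on {a..b}) (\<lambda>x. (cmod (f x + g x))\<^sup>2)"
  proof (rule Bochner_Integration.integrable_bound)
    show "integrable (lebesgue_on {a..b}) (\<lambda>x. 2 * (cmod (f x))^2 + 2 * (cmod (g x))^2)"
      using f g by (auto simp: L2_on_def)
    have "(cmod (y + z))\<^sup>2 \<le> 2 * (cmod y)^2 + 2 * (cmod z)^2" for y z
    proof -
      have "(cmod (y + z))\<^sup>2 \<le> (cmod y + cmod z)^2"
        by (intro power_mono norm_triangle_ineq) auto
      also have "\<dots> \<le> 2 * (cmod y)^2 + 2 * (cmod z)^2"
        using zero_le_power2[of "cmod y - cmod z"] by (simp add: power2_eq_square algebra_simps)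
      finally show ?thesis .
    qed
    then show "AE x in lebesgue_on {a..b}. norm ((cmod (f x + g x))\<^sup>2) \<le> norm (2 * (cmod (f x))^2 + 2 * (cmod (g x))^2)"
      by (auto simp: abs_of_nonneg)
  qed measurable
qed

lemma L2_on_cmult:
  assumes "L2_on a b f"
  shows "L2_on a b (\<lambda>x. c * f x)"
  using assms by (auto simp: L2_on_def norm_mult power_mult_distrib)

lemma L2_on_mult_integrable:
  assumes f: "L2_on a b f" and g: "L2_on a b g"
  shows "integrable (lebesgue_on {a..b}) (\<lambda>x. f x * g x)"
proof (rule Bochner_Integration.integrable_bound)
  show "integrable (lebesgue_on {a..b}) (\<lambda>x. (cmod (f x))^2 + (cmod (g x))^2)"
    using f g by (auto simp: L2_on_def)
  show "(\<lambda>x. f x * g x) \<in> borel_measurable (lebesgue_on {a..b})"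
    using f g by (auto simp: L2_on_def)
  have "y * z \<le> y^2 + z^2" if "y \<ge> 0" "z \<ge> 0" for y z :: real
  proof -
    have "y * z \<ge> 0" using that by simp
    moreover have "2 * (y * z) \<le> y^2 + z^2"
      using zero_le_power2[of "y - z"] by (simp add: power2_eq_square algebra_simps)
    ultimately show ?thesis by linarith
  qed
  then show "AE x in lebesgue_on {a..b}. norm (f x * g x) \<le> norm ((cmod (f x))^2 + (cmod (g x))^2)"
    by (auto simp: norm_mult)
qed

lemma borel_measurable_cnj:
  "f \<in> borel_measurable M \<Longrightarrow> (\<lambda>x. cnj (f x)) \<in> borel_measurable M"
  by (rule measurable_compose[OF _ borel_measurable_continuous_onI]) (auto intro!: continuous_intros)

lemma L2_on_cnj: "L2_on a b f \<Longrightarrow> L2_on a b (\<lambda>x. cnj (f x))"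
  by (auto simp: L2_on_def intro: borel_measurable_cnj)

lemma H1_on_iff: "H1_on a b u \<longleftrightarrow> (\<exists>g. L2_on a b g \<and> weak_derivative_on a b u g)"
  unfolding H1_on_def weak_derivative_on_def using L2_on_imp_integrable by blast

lemma H1_on_wderiv:
  assumes "H1_on a b u"
  shows "L2_on a b (wderiv_on a b u)" "weak_derivative_on a b u (wderiv_on a b u)"
proof -
  have "L2_on a b (wderiv_on a b u) \<and> (\<forall>x\<in>{a..b}. u x = u a + integral\<^sup>L (lebesgue_on {a..x}) (wderiv_on a b u))"
    unfolding wderiv_on_def using assms unfolding H1_on_def by (rule someI_ex)
  then show "L2_on a b (wderiv_on a b u)" "weak_derivative_on a b u (wderiv_on a b u)"
    unfolding weak_derivative_on_def using L2_on_imp_integrable by blast+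
qed

text \<open>\<open>wderiv_on\<close> is an arbitrary choice, hence determined only up to null sets:
  the difference of two weak derivatives of \<open>u\<close> has vanishing indefinite
  integral.\<close>

lemma wderiv_on_AE_eq:
  assumes "a \<le> b" "L2_on a b g" and u: "weak_derivative_on a b u g"
  shows "AE x in lebesgue_on {a..b}. wderiv_on a b u x = g x"
proof -
  have H: "H1_on a b u" using assms H1_on_iff by blast
  let ?k = "wderiv_on a b u"
  have k: "weak_derivative_on a b u ?k" by (rule H1_on_wderiv[OF H])
  have z: "weak_derivative_on a b (\<lambda>x. u x + (-1) * u x) (\<lambda>x. ?k x + (-1) * g x)"
    by (intro weak_derivative_add weak_derivative_cmult k u)
  have "AE x in lebesgue_on {a..b}. ?k x + (-1) * g x = 0"
  proof (rule indefinite_integral_zero_imp_AE_zero[OF \<open>a \<le> b\<close> weak_derivative_integrable[OF z]])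
    fix x assume "x \<in> {a..b}"
    from weak_derivative_eq[OF z this] show "(\<integral>x. ?k x + (-1) * g x \<partial>lebesgue_on {a..x}) = 0"
      by simp
  qed
  then show ?thesis by eventually_elim simp
qed

lemma ipL2_cong_AE:
  assumes "L2_on 0 1 f" "L2_on 0 1 g" "L2_on 0 1 f'" "L2_on 0 1 g'"
    and "AE x in lebesgue_on {0..1}. f x = f' x" "AE x in lebesgue_on {0..1}. g x = g' x"
  shows "ipL2 f g = ipL2 f' g'"
  unfolding ipL2_def
proof (rule integral_cong_AE)
  show "AE x in lebesgue_on {0..1}. f x * cnj (g x) = f' x * cnj (g' x)"
    using assms(5,6) by eventually_elim simp
qed (use assms in \<open>auto simp: L2_on_def intro!: borel_measurable_times borel_measurable_cnj\<close>)

section \<open>The resolvent\<close>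

lemma H10_wderiv:
  assumes "H10 u"
  shows "L2 (wderiv u)" "weak_derivative_on 0 1 u (wderiv u)" "u 0 = 0" "u 1 = 0" "continuous_on {0..1} u"
  using assms H1_on_wderiv[of 0 1 u] weak_derivative_continuous[of 0 1 u "wderiv u"] unfolding H10_def by blast+

lemma H10I:
  assumes "weak_derivative_on 0 1 u g" "L2 g" "u 0 = 0" "u 1 = 0"
  shows "H10 u"
  using assms unfolding H10_def H1_on_iff by blast

lemma H10_uminus:
  assumes "H10 u" shows "H10 (\<lambda>x. - u x)"
proof -
  have "weak_derivative_on 0 1 (\<lambda>x. - 1 * u x) (\<lambda>x. - 1 * wderiv u x)"
    by (rule weak_derivative_cmult[OF H10_wderiv(2)[OF assms]])
  from H10I[OF this L2_on_cmult[OF H10_wderiv(1)[OF assms]]] show ?thesis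
    using H10_wderiv(3,4)[OF assms] by simp
qed

lemma dx_dual_by_parts:
  assumes y: "\<And>x. x \<in> {0..1} \<Longrightarrow> (y has_vector_derivative y' x) (at x within {0..1})"
    and y': "continuous_on {0..1} y'" and \<phi>: "H10 \<phi>"
  shows "dx_dual y \<phi> = ipL2 y' \<phi>"
proof -
  have "(\<integral>x. cnj (wderiv \<phi> x) * y x \<partial>lebesgue_on {0..1}) =
     cnj (\<phi> 1) * y 1 - cnj (\<phi> 0) * y 0 - (\<integral>x. cnj (\<phi> x) * y' x \<partial>lebesgue_on {0..1})"
    by (rule weak_derivative_by_parts[OF _ weak_derivative_cnj[OF H10_wderiv(2)[OF \<phi>]] y y']) auto
  then show ?thesis
    using H10_wderiv(3,4)[OF \<phi>] by (simp add: dx_dual_def ipL2_def mult.commute)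
qed

text \<open>Changing derivatives on a null set does not affect the integral, so any explicitly known
  pair of weak derivatives can replace the chosen ones.\<close>

lemma ipH1_eq:
  assumes w: "weak_derivative_on 0 1 w g" "L2 g" and \<phi>: "weak_derivative_on 0 1 \<phi> k" "L2 k"
  shows "ipH1 w \<phi> = ipL2 g k + ipL2 w \<phi>"
proof -
  have "H1_on 0 1 w" "H1_on 0 1 \<phi>" using w \<phi> H1_on_iff by blast+
  then have "ipL2 (wderiv w) (wderiv \<phi>) = ipL2 g k"
    using w \<phi> by (intro ipL2_cong_AE wderiv_on_AE_eq H1_on_wderiv) auto
  then show ?thesis by (simp add: ipH1_def)
qed

lemma has_vector_derivative_of_real_cosh_sinh:
  "((\<lambda>x. complex_of_real (cosh x)) has_vector_derivative complex_of_real (sinh x)) (at x within A)"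
  "((\<lambda>x. complex_of_real (sinh x)) has_vector_derivative complex_of_real (cosh x)) (at x within A)"
  by (auto intro!: has_vector_derivative_of_real derivative_eq_intros)

text \<open>Variation of constants: with \<open>y\<close> solving \<open>y'' = y - v\<close>, \<open>y'(0) = y'(1) = 0\<close>, the function
  \<open>w = y'\<close> has weak derivative \<open>y - v\<close>, which makes it the representative.\<close>
lemma dx_dual_representable:
  assumes v: "L2 v"
  shows "\<exists>w. H10 w \<and> (\<forall>\<phi>. H10 \<phi> \<longrightarrow> ipH1 w \<phi> = dx_dual v \<phi>)"
proof -
  define ch sh where "ch = (\<lambda>x. complex_of_real (cosh x))" and "sh = (\<lambda>x. complex_of_real (sinh x))"
  have d: "(ch has_vector_derivative sh x) (at x within A)" "(sh has_vector_derivative ch x) (at x within A)" for x A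
    unfolding ch_def sh_def by (rule has_vector_derivative_of_real_cosh_sinh)+
  have cc: "continuous_on A ch" "continuous_on A sh" for A
    unfolding ch_def sh_def by (intro continuous_intros)+
  have cs: "ch x * ch x - sh x * sh x = 1" for x
    using cosh_square_eq[of x] by (simp add: ch_def sh_def power2_eq_square flip: of_real_mult of_real_diff)
  have vi: "integrable (lebesgue_on {0..1}) v" by (rule L2_on_imp_integrable[OF v])
  define C S where "C = (\<lambda>x. \<integral>s. v s * ch s \<partial>lebesgue_on {0..x})" and "S = (\<lambda>x. \<integral>s. v s * sh s \<partial>lebesgue_on {0..x})"
  have z: "integral\<^sup>L (lebesgue_on {0}) f = 0" for f :: "real \<Rightarrow> complex"
  proof -
    have "integrable (lebesgue_on {0..0}) f" by (rule continuous_imp_integrable_real) simp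
    then show ?thesis by (subst lebesgue_integral_eq_integral) simp_all
  qed
  have C: "weak_derivative_on 0 1 C (\<lambda>x. v x * ch x)"
    by (rule weak_derivativeI) (auto simp: C_def z intro!: integrable_mult_continuous vi cc)
  have S: "weak_derivative_on 0 1 S (\<lambda>x. v x * sh x)"
    by (rule weak_derivativeI) (auto simp: S_def z intro!: integrable_mult_continuous vi cc)
  \<comment> \<open>The homogeneous solution \<open>sh\<close> is added with the coefficient that
    makes \<open>w 1 = 0\<close>; \<open>w 0 = 0\<close> holds already because \<open>sh 0\<close>
    and \<open>C 0\<close> vanish.\<close>
  define K where "K = (ch 1 * C 1 - sh 1 * S 1) / sh 1"
  define w where "w = (\<lambda>x. S x * sh x + K * sh x + (-1) * (C x * ch x))"
  define y where "y = (\<lambda>x. S x * ch x + K * ch x + (-1) * (C x * sh x))"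
  have "sh 1 \<noteq> 0" by (simp add: sh_def)
  then have w01: "w 0 = 0" "w 1 = 0"
    by (simp_all add: w_def K_def C_def z sh_def[THEN fun_cong, of 0] field_simps)
  have wd: "weak_derivative_on 0 1 w (\<lambda>x. (v x * sh x * sh x + S x * ch x) + K * ch x + (-1) * (v x * ch x * ch x + C x * sh x))"
    unfolding w_def
    by (intro weak_derivative_add weak_derivative_mult_C1[OF S] weak_derivative_mult_C1[OF C]
         weak_derivative_cmult weak_derivative_C1 d cc)
  \<comment> \<open>The terms containing \<open>v\<close> combine to
    \<open>- v x * (ch x * ch x - sh x * sh x)\<close>, which is \<open>- v x\<close>. In the
    derivative of \<open>y\<close> computed next, the corresponding terms cancel.\<close>
  have alg: "(v x * sh x * sh x + S x * ch x) + K * ch x + (-1) * (v x * ch x * ch x + C x * sh x) = -1 * v x + y x" for x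
  proof -
    have "(v x * sh x * sh x + S x * ch x) + K * ch x + (-1) * (v x * ch x * ch x + C x * sh x)
      = - v x * (ch x * ch x - sh x * sh x) + y x" by (simp add: y_def algebra_simps)
    then show ?thesis by (simp add: cs)
  qed
  have wd': "weak_derivative_on 0 1 w (\<lambda>x. -1 * v x + y x)"
    by (rule weak_derivative_cong[OF wd]) (simp, simp, rule alg)
  have yd0: "weak_derivative_on 0 1 y (\<lambda>x. (v x * sh x * ch x + S x * sh x) + K * sh x + (-1) * (v x * ch x * sh x + C x * ch x))"
    unfolding y_def
    by (intro weak_derivative_add weak_derivative_mult_C1[OF S] weak_derivative_mult_C1[OF C]
         weak_derivative_cmult weak_derivative_C1 d cc)
  have yd: "weak_derivative_on 0 1 y w"
    by (rule weak_derivative_cong[OF yd0]) (simp_all add: w_def algebra_simps)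
  have wc: "continuous_on {0..1} w" and yc: "continuous_on {0..1} y"
    using weak_derivative_continuous wd' yd by blast+
  have yL: "L2 y" by (rule L2_on_continuous[OF yc])
  have gL: "L2 (\<lambda>x. -1 * v x + y x)"
    by (intro L2_on_add L2_on_cmult v yL)
  have "H10 w" by (rule H10I[OF wd' gL w01])
  moreover have "ipH1 w \<phi> = dx_dual v \<phi>" if \<phi>: "H10 \<phi>" for \<phi>
  proof -
    note \<phi>' = H10_wderiv[OF \<phi>]
    have "ipH1 w \<phi> = ipL2 (\<lambda>x. -1 * v x + y x) (wderiv \<phi>) + ipL2 w \<phi>"
      by (rule ipH1_eq[OF wd' gL \<phi>'(2,1)])
    also have "ipL2 (\<lambda>x. -1 * v x + y x) (wderiv \<phi>) = (\<integral>x. y x * cnj (wderiv \<phi> x) - v x * cnj (wderiv \<phi> x) \<partial>lebesgue_on {0..1})"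
      by (simp add: ipL2_def algebra_simps)
    also have "\<dots> = ipL2 y (wderiv \<phi>) - ipL2 v (wderiv \<phi>)"
      unfolding ipL2_def by (intro Bochner_Integration.integral_diff L2_on_mult_integrable L2_on_cnj yL v \<phi>')
    \<comment> \<open>\<open>y\<close> is classically differentiable because its weak derivative
      \<open>w\<close> is continuous; its contribution then cancels the zero-order term
      \<open>ipL2 w \<phi>\<close>.\<close>
    also have "ipL2 y (wderiv \<phi>) = - ipL2 w \<phi>"
      using dx_dual_by_parts[OF weak_derivative_continuous_imp_C1[OF yd wc] wc \<phi>] by (metis dx_dual_def minus_minus)
    finally show ?thesis by (simp add: dx_dual_def)
  qed
  ultimately show ?thesis by blast
qed

lemma resolvent_dx_dual:
  assumes "L2 v"
  shows "H10 (resolvent (dx_dual v))"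
    and "H10 \<phi> \<Longrightarrow> ipH1 (resolvent (dx_dual v)) \<phi> = dx_dual v \<phi>"
  using someI_ex[OF dx_dual_representable[OF assms]] unfolding resolvent_def by auto

text \<open>On \<open>H10\<close> the functional of \<open>f\<close> coincides with the
  distributional derivative of an antiderivative \<open>y\<close>. The choice inside
  \<open>resolvent\<close> sees functionals only through their values on \<open>H10\<close>, so both
  resolvents are the same function.\<close>

lemma resolvent_embL2:
  assumes y: "\<And>x. x \<in> {0..1} \<Longrightarrow> (y has_vector_derivative f x) (at x within {0..1})"
    and f: "continuous_on {0..1} f"
  shows "H10 (resolvent (embL2 f))"
    and "H10 \<phi> \<Longrightarrow> ipH1 (resolvent (embL2 f)) \<phi> = ipL2 f \<phi>"
proof -
  have "continuous_on {0..1} y"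
    using y by (meson continuous_on_eq_continuous_within has_vector_derivative_continuous)
  then have yL: "L2 y" by (rule L2_on_continuous)
  have eq: "embL2 f \<phi> = dx_dual y \<phi>" if "H10 \<phi>" for \<phi>
    using dx_dual_by_parts[OF y f that] by (simp add: embL2_def)
  then have "resolvent (embL2 f) = resolvent (dx_dual y)"
    unfolding resolvent_def by (metis (no_types, lifting))
  then show "H10 (resolvent (embL2 f))" "H10 \<phi> \<Longrightarrow> ipH1 (resolvent (embL2 f)) \<phi> = ipL2 f \<phi>"
    using resolvent_dx_dual[OF yL] eq by (simp_all add: embL2_def)
qed

section \<open>Coordinates along the eigenfunctions\<close>

definition eig_scale :: "int \<Rightarrow> real" where
  "eig_scale n = sqrt (1 + (real_of_int n * pi)^2)"

text \<open>The eigenvalue of A along \<open>eigU n\<close> is \<i> times this number, including n =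
  0.\<close>

definition eig_freq :: "int \<Rightarrow> real" where
  "eig_freq n = real_of_int n * pi / eig_scale n"

definition sine_coeff :: "(real \<Rightarrow> complex) \<Rightarrow> int \<Rightarrow> complex" where
  "sine_coeff u n = (\<integral>x. u x * complex_of_real (sin (real_of_int n * pi * x)) \<partial>lebesgue_on {0..1})"

definition cosine_coeff :: "(real \<Rightarrow> complex) \<Rightarrow> int \<Rightarrow> complex" where
  "cosine_coeff v n = (\<integral>x. v x * complex_of_real (cos (real_of_int n * pi * x)) \<partial>lebesgue_on {0..1})"

lemma eig_scale_pos [simp]: "eig_scale n > 0" "eig_scale n \<noteq> 0"
proof -
  show "eig_scale n > 0" unfolding eig_scale_def by (simp add: add_pos_nonneg)
  then show "eig_scale n \<noteq> 0" by simp
qed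

lemma eig_scale_square: "eig_scale n * eig_scale n = 1 + (real_of_int n * pi)^2"
  unfolding eig_scale_def by (simp add: add_nonneg_nonneg)

lemma eigU_nonzero:
  assumes "n \<noteq> 0"
  shows "fst (eigU n) = (\<lambda>x. complex_of_real (sin (real_of_int n * pi * x) / eig_scale n))"
    "snd (eigU n) = (\<lambda>x. \<i> * complex_of_real (cos (real_of_int n * pi * x)))"
  using assms by (simp_all add: eigU_def eig_scale_def)

lemma eigU_zero: "fst (eigU 0) = (\<lambda>x. 0)" "snd (eigU 0) = (\<lambda>x. 1)"
  by (simp_all add: eigU_def)

lemma has_vector_derivative_of_real_trig:
  "((\<lambda>x. complex_of_real (sin (m * x))) has_vector_derivative complex_of_real (m * cos (m * x))) (at x within A)"
  "((\<lambda>x. complex_of_real (cos (m * x))) has_vector_derivative complex_of_real (- (m * sin (m * x)))) (at x within A)"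
  by (auto intro!: has_vector_derivative_of_real derivative_eq_intros)

lemma fst_eigU:
  shows "H10 (fst (eigU n))"
    and "weak_derivative_on 0 1 (fst (eigU n)) (\<lambda>x. complex_of_real (eig_freq n * cos (real_of_int n * pi * x)))"
    and "L2 (\<lambda>x. complex_of_real (eig_freq n * cos (real_of_int n * pi * x)))"
proof -
  let ?m = "real_of_int n * pi"
  let ?g = "\<lambda>x. complex_of_real (eig_freq n * cos (?m * x))"
  \<comment> \<open>The sine formula also covers n = 0, where both sides are 0.\<close>
  have eq: "fst (eigU n) x = complex_of_real (1 / eig_scale n) * complex_of_real (sin (?m * x))" for x
    by (cases "n = 0") (simp_all add: eigU_nonzero eigU_zero)
  have "weak_derivative_on 0 1 (\<lambda>x. complex_of_real (1 / eig_scale n) * complex_of_real (sin (?m * x)))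
      (\<lambda>x. complex_of_real (1 / eig_scale n) * complex_of_real (?m * cos (?m * x)))"
    by (intro weak_derivative_cmult weak_derivative_C1 has_vector_derivative_of_real_trig continuous_intros)
  then show wd: "weak_derivative_on 0 1 (fst (eigU n)) ?g"
    by (rule weak_derivative_cong) (simp_all add: eq eig_freq_def)
  show "L2 ?g" by (intro L2_on_continuous continuous_intros)
  from H10I[OF wd this] show "H10 (fst (eigU n))"
    by (simp add: eq mult.commute[of _ pi] sin_npi_int)
qed

lemma eigU_in_Hspace: "eigU n \<in> Hspace"
proof -
  have "L2 (snd (eigU n))"
    by (cases "n = 0") (auto simp: eigU_nonzero eigU_zero intro!: L2_on_continuous continuous_intros)
  then show ?thesis using fst_eigU(1)[of n] by (simp add: Hspace_def case_prod_unfold)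
qed

text \<open>Integration by parts; the boundary terms drop out because \<open>u\<close> vanishes at 0
  and 1, although the cosine does not.\<close>

lemma cosine_coeff_wderiv:
  assumes "H10 u"
  shows "cosine_coeff (wderiv u) n = complex_of_real (real_of_int n * pi) * sine_coeff u n"
proof -
  let ?m = "real_of_int n * pi"
  have "cosine_coeff (wderiv u) n = - (\<integral>x. u x * complex_of_real (- (?m * sin (?m * x))) \<partial>lebesgue_on {0..1})"
    unfolding cosine_coeff_def
    by (subst weak_derivative_by_parts[OF _ H10_wderiv(2)[OF assms] has_vector_derivative_of_real_trig(2)])
       (auto intro!: continuous_intros simp: H10_wderiv[OF assms])
  also have "\<dots> = - (\<integral>x. - complex_of_real ?m * (u x * complex_of_real (sin (?m * x))) \<partial>lebesgue_on {0..1})"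
    by (simp add: algebra_simps)
  also have "\<dots> = complex_of_real ?m * sine_coeff u n"
    unfolding sine_coeff_def by (subst integral_mult_right_zero) simp
  finally show ?thesis .
qed

text \<open>Both terms of the H^1 product are multiples of the same sine coefficient. Their weights
  (n \<pi>)^2 and 1, divided by \<open>eig_scale n\<close>, add up to
  \<open>eig_scale n\<close>.\<close>

lemma ipH1_fst_eigU:
  assumes "H10 u"
  shows "ipH1 u (fst (eigU n)) = (if n = 0 then 0 else complex_of_real (eig_scale n) * sine_coeff u n)"
proof -
  let ?m = "real_of_int n * pi"
  have eq: "fst (eigU n) x = complex_of_real (1 / eig_scale n) * complex_of_real (sin (?m * x))" for x
    by (cases "n = 0") (simp_all add: eigU_nonzero eigU_zero)
  have "ipH1 u (fst (eigU n)) = ipL2 (wderiv u) (\<lambda>x. complex_of_real (eig_freq n * cos (?m * x))) + ipL2 u (fst (eigU n))"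
    by (rule ipH1_eq[OF H10_wderiv(2,1)[OF assms] fst_eigU(2,3)])
  also have "ipL2 (wderiv u) (\<lambda>x. complex_of_real (eig_freq n * cos (?m * x))) = complex_of_real (eig_freq n) * cosine_coeff (wderiv u) n"
    unfolding ipL2_def cosine_coeff_def by (subst integral_mult_right_zero[symmetric]) (simp add: ac_simps)
  also have "ipL2 u (fst (eigU n)) = complex_of_real (1 / eig_scale n) * sine_coeff u n"
    unfolding ipL2_def sine_coeff_def eq by (subst integral_mult_right_zero[symmetric]) (simp add: ac_simps)
  also have "complex_of_real (eig_freq n) * cosine_coeff (wderiv u) n + complex_of_real (1 / eig_scale n) * sine_coeff u n
    = complex_of_real ((?m * ?m + 1) / eig_scale n) * sine_coeff u n"
    unfolding cosine_coeff_wderiv[OF assms] by (simp add: eig_freq_def add_divide_distrib algebra_simps)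
  also have "(?m * ?m + 1) / eig_scale n = eig_scale n"
    using eig_scale_square[of n] by (simp add: field_simps power2_eq_square)
  finally show ?thesis
    by (auto simp: sine_coeff_def)
qed

lemma ipL2_snd_eigU: "ipL2 v (snd (eigU n)) = (if n = 0 then 1 else - \<i>) * cosine_coeff v n"
proof (cases "n = 0")
  case True then show ?thesis by (simp add: eigU_zero ipL2_def cosine_coeff_def)
next
  case False
  then have "ipL2 v (snd (eigU n)) = (\<integral>x. - \<i> * (v x * complex_of_real (cos (real_of_int n * pi * x))) \<partial>lebesgue_on {0..1})"
    by (simp add: eigU_nonzero ipL2_def algebra_simps)
  then show ?thesis
    using False by (simp only: integral_mult_right_zero cosine_coeff_def if_False)
qed

section \<open>The operator, the semigroup and the forcing in eigenfunction coordinates\<close>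

lemma opA_in_Hspace:
  assumes "X \<in> Hspace" shows "opA X \<in> Hspace"
proof -
  have X: "H10 (fst X)" "L2 (snd X)" using assms by (auto simp: Hspace_def)
  have "H10 (\<lambda>x. - resolvent (dx_dual (snd X)) x)"
    by (intro H10_uminus resolvent_dx_dual X)
  moreover have "L2 (\<lambda>x. (-1) * wderiv (fst X) x)"
    by (rule L2_on_cmult[OF H10_wderiv(1)[OF X(1)]])
  ultimately show ?thesis by (simp add: Hspace_def opA_def)
qed

lemma ipH1_uminus_fst_eigU:
  assumes "H10 u"
  shows "ipH1 (\<lambda>x. - u x) (fst (eigU n)) = - ipH1 u (fst (eigU n))"
  unfolding ipH1_fst_eigU[OF assms] ipH1_fst_eigU[OF H10_uminus[OF assms]] by (simp add: sine_coeff_def)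

text \<open>This is skew-adjointness combined with the eigenvalue equation: (A X, U_n) = -(X, A
  U_n), and conjugating the imaginary eigenvalue restores the sign. The proof checks it component by
  component.\<close>

lemma ipH_opA_eigU:
  assumes "X \<in> Hspace"
  shows "ipH (opA X) (eigU n) = \<i> * complex_of_real (eig_freq n) * ipH X (eigU n)"
proof -
  let ?m = "real_of_int n * pi"
  have X: "H10 (fst X)" "L2 (snd X)" using assms by (auto simp: Hspace_def)
  let ?r = "resolvent (dx_dual (snd X))"
  \<comment> \<open>The weak formulation of the resolvent is tested with the first component of
    \<open>eigU n\<close>, whose derivative is a multiple of the cosine; this brings in the cosine
    coefficient of the second component of \<open>X\<close>.\<close>
  have "ipH1 (\<lambda>x. - ?r x) (fst (eigU n)) = - dx_dual (snd X) (fst (eigU n))"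
    using ipH1_uminus_fst_eigU[OF resolvent_dx_dual(1)[OF X(2)]] resolvent_dx_dual(2)[OF X(2) fst_eigU(1)] by simp
  also have "\<dots> = ipL2 (snd X) (wderiv (fst (eigU n)))" by (simp add: dx_dual_def)
  also have "\<dots> = ipL2 (snd X) (\<lambda>x. complex_of_real (eig_freq n * cos (?m * x)))"
    using fst_eigU H10_wderiv(1)[OF fst_eigU(1)] X
    by (intro ipL2_cong_AE wderiv_on_AE_eq) auto
  also have "\<dots> = complex_of_real (eig_freq n) * cosine_coeff (snd X) n"
    unfolding ipL2_def cosine_coeff_def by (subst integral_mult_right_zero[symmetric]) (simp add: ac_simps)
  finally have 1: "ipH1 (\<lambda>x. - ?r x) (fst (eigU n)) = complex_of_real (eig_freq n) * cosine_coeff (snd X) n" .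
  have 2: "cosine_coeff (\<lambda>x. - wderiv (fst X) x) n = - complex_of_real ?m * sine_coeff (fst X) n"
    using cosine_coeff_wderiv[OF X(1), of n] by (simp add: cosine_coeff_def)
  show ?thesis
    unfolding ipH_def ipL2_snd_eigU ipH1_fst_eigU[OF X(1)]
    by (simp add: opA_def 1 2) (auto simp: eig_freq_def algebra_simps)
qed

text \<open>Each application of \<open>opA\<close> multiplies the coordinate by the eigenvalue, so
  the operator series becomes a scalar exponential series.\<close>

lemma semigrp_ip_eigU:
  assumes "X \<in> Hspace"
  shows "semigrp_ip s X (eigU n) = exp (- (\<i> * complex_of_real (eig_freq n * s))) * ipH X (eigU n)"
proof -
  let ?l = "\<i> * complex_of_real (eig_freq n)"
  have k: "(opA ^^ k) X \<in> Hspace \<and> ipH ((opA ^^ k) X) (eigU n) = ?l ^ k * ipH X (eigU n)" for k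
    by (induction k) (auto simp: assms opA_in_Hspace ipH_opA_eigU)
  have "(\<lambda>k. (- (\<i> * complex_of_real (eig_freq n * s))) ^ k /\<^sub>R fact k * ipH X (eigU n)) sums
      (exp (- (\<i> * complex_of_real (eig_freq n * s))) * ipH X (eigU n))"
    by (intro sums_mult2 exp_converges)
  moreover have "(- (\<i> * complex_of_real (eig_freq n * s))) ^ k /\<^sub>R fact k * ipH X (eigU n) =
     complex_of_real ((- s) ^ k / fact k) * ipH ((opA ^^ k) X) (eigU n)" for k
  proof -
    have "- (\<i> * complex_of_real (eig_freq n * s)) = complex_of_real (- s) * ?l" by simp
    then show ?thesis using k[of k]
      by (simp only: power_mult_distrib scaleR_conv_of_real) (simp add: field_simps)
  qed
  ultimately show ?thesis unfolding semigrp_ip_def by (simp add: sums_iff)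
qed

text \<open>For n \<noteq> 0 the constant second component is orthogonal to the cosine, and only the
  integral of x sin(n \<pi> x) survives; for n = 0 only the second component contributes.\<close>

lemma forcing_eigU:
  shows "forcing T h t \<in> Hspace"
    and "ipH (forcing T h t) (eigU n) = (if n = 0 then h t
      else complex_of_real (cos (real_of_int n * pi)) / complex_of_real (real_of_int n * pi * eig_scale n) * wderiv_on 0 T h t)"
proof -
  let ?m = "real_of_int n * pi"
  let ?c = "wderiv_on 0 T h t"
  let ?f = "\<lambda>y. complex_of_real y * ?c"
  let ?r = "resolvent (embL2 ?f)"
  \<comment> \<open>The antiderivative of the linear load, as \<open>resolvent_embL2\<close>
    requires.\<close>
  have d: "((\<lambda>y. complex_of_real (y^2 / 2) * ?c) has_vector_derivative ?f x) (at x within {0..1})" for x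
    by (intro has_vector_derivative_mult_left has_vector_derivative_of_real)
       (auto intro!: derivative_eq_intros)
  have c: "continuous_on {0..1} ?f" by (intro continuous_intros)
  note r = resolvent_embL2[OF d c]
  show "forcing T h t \<in> Hspace"
    using H10_uminus[OF r(1)] by (auto simp: forcing_def Hspace_def intro: L2_on_continuous)
  have cos0: "cosine_coeff (\<lambda>x. h t) n = 0" if "n \<noteq> 0"
  proof -
    have "(\<integral>x. h t * complex_of_real (cos (?m * x)) \<partial>lebesgue_on {0..1}) = h t * complex_of_real (sin (?m * 1) / ?m) - h t * complex_of_real (sin (?m * 0) / ?m)"
    proof (rule FTC_lebesgue_on)
      show "((\<lambda>x. h t * complex_of_real (sin (?m * x) / ?m)) has_vector_derivative h t * complex_of_real (cos (?m * x))) (at x within {0..1})" for x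
        using that by (intro has_vector_derivative_mult_right has_vector_derivative_of_real)
          (auto intro!: derivative_eq_intros)
    qed (auto intro!: continuous_intros)
    then show ?thesis by (simp add: cosine_coeff_def mult.commute[of _ pi] sin_npi_int)
  qed
  have 1: "ipH1 (\<lambda>x. - ?r x) (fst (eigU n)) = - ipL2 ?f (fst (eigU n))"
    using ipH1_uminus_fst_eigU[OF r(1)] r(2)[OF fst_eigU(1)] by simp
  have 2: "ipL2 ?f (fst (eigU n)) = - complex_of_real (cos (real_of_int n * pi)) / complex_of_real (real_of_int n * pi * eig_scale n) * ?c" if "n \<noteq> 0"
  proof -
    \<comment> \<open>An antiderivative of \<open>x * sin (?m * x) / eig_scale n\<close>, found by
      parts; at 0 it vanishes and at 1 only the cosine term remains.\<close>
    define F where "F = (\<lambda>x. (sin (?m * x) / ?m - x * cos (?m * x)) / (?m * eig_scale n))"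
    have "ipL2 ?f (fst (eigU n)) = (\<integral>x. ?c * complex_of_real (x * sin (?m * x) / eig_scale n) \<partial>lebesgue_on {0..1})"
      unfolding ipL2_def eigU_nonzero[OF that] by (simp add: ac_simps)
    also have "\<dots> = ?c * complex_of_real (F 1) - ?c * complex_of_real (F 0)"
    proof (rule FTC_lebesgue_on)
      show "((\<lambda>x. ?c * complex_of_real (F x)) has_vector_derivative ?c * complex_of_real (x * sin (?m * x) / eig_scale n)) (at x within {0..1})" for x
        unfolding F_def using that
        by (intro has_vector_derivative_mult_right has_vector_derivative_of_real)
          (auto intro!: derivative_eq_intros simp: field_simps)
    qed (auto intro!: continuous_intros)
    finally show ?thesis using that by (simp add: F_def mult.commute[of _ pi] sin_npi_int)
  qed
  show "ipH (forcing T h t) (eigU n) = (if n = 0 then h t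
      else complex_of_real (cos (real_of_int n * pi)) / complex_of_real (real_of_int n * pi * eig_scale n) * wderiv_on 0 T h t)"
    unfolding ipH_def ipL2_snd_eigU
    by (auto simp: forcing_def 1 2 cos0) (simp_all add: cosine_coeff_def ipL2_def eigU_zero measure_restrict_space)
qed

section \<open>Moments of the control and spectral uncontrollability\<close>

lemma H10_sum:
  assumes "finite S" "\<And>n. H10 (f n)"
  shows "H10 (\<lambda>x. \<Sum>n\<in>S. c n * f n x)"
proof -
  have "\<exists>g. weak_derivative_on 0 1 (\<lambda>x. \<Sum>n\<in>S. c n * f n x) g \<and> L2 g"
    using assms(1)
  proof (induction S)
    case empty
    have "weak_derivative_on 0 1 (\<lambda>x. 0) (\<lambda>x. 0)" by (rule weak_derivativeI) auto
    then show ?case by (auto intro!: exI[of _ "\<lambda>x. 0"] L2_on_continuous)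
  next
    case (insert n S)
    then obtain g where g: "weak_derivative_on 0 1 (\<lambda>x. \<Sum>n\<in>S. c n * f n x) g" "L2 g" by blast
    have "weak_derivative_on 0 1 (\<lambda>x. c n * f n x + (\<Sum>n\<in>S. c n * f n x)) (\<lambda>x. c n * wderiv (f n) x + g x)"
      by (intro weak_derivative_add weak_derivative_cmult g H10_wderiv assms)
    moreover have "L2 (\<lambda>x. c n * wderiv (f n) x + g x)"
      by (intro L2_on_add L2_on_cmult g H10_wderiv assms)
    ultimately show ?case using insert by auto
  qed
  then show ?thesis
    using H10_wderiv(3,4)[OF assms(2)] by (auto intro: H10I)
qed

lemma H10_cong:
  assumes "H10 u" "\<And>x. x \<in> {0..1} \<Longrightarrow> u x = u' x"
  shows "H10 u'"
proof (rule H10I)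
  show "weak_derivative_on 0 1 u' (wderiv u)"
    by (rule weak_derivative_cong[OF H10_wderiv(2)[OF assms(1)]]) (use assms in auto)
qed (use assms(2)[of 0] assms(2)[of 1] H10_wderiv[OF assms(1)] in auto)

lemma ipH_eigU:
  assumes "H10 u"
  shows "ipH (u, v) (eigU n) = (if n = 0 then cosine_coeff v 0
    else complex_of_real (eig_scale n) * sine_coeff u n - \<i> * cosine_coeff v n)"
  unfolding ipH_def ipL2_snd_eigU by (simp add: ipH1_fst_eigU[OF assms])

section \<open>The exponential transform of the control: holomorphy and zeros\<close>

definition exp_transform :: "real \<Rightarrow> (real \<Rightarrow> complex) \<Rightarrow> complex \<Rightarrow> complex" where
  "exp_transform T h z = integral {0..T} (\<lambda>t. h t * exp (z * complex_of_real t))"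

lemma exp_transform_holomorphic:
  assumes "continuous_on {0..T} h"
  shows "exp_transform T h holomorphic_on UNIV"
proof -
  have "(\<lambda>z. integral (cbox 0 T) (\<lambda>t. h t * exp (z * complex_of_real t))) holomorphic_on UNIV"
  proof (rule leibniz_rule_holomorphic)
    show "((\<lambda>z. h t * exp (z * complex_of_real t)) has_field_derivative
        h t * (exp (z * complex_of_real t) * complex_of_real t)) (at z within UNIV)" for z t
      by (auto intro!: derivative_eq_intros)
    show "(\<lambda>t. h t * exp (z * complex_of_real t)) integrable_on cbox 0 T" for z
      using assms by (intro integrable_continuous continuous_intros) simp
    show "continuous_on (UNIV \<times> cbox 0 T) (\<lambda>(z, t). h t * (exp (z * complex_of_real t) * complex_of_real t))"
      unfolding case_prod_unfold
      by (intro continuous_intros continuous_on_compose2[OF assms]) auto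
  qed auto
  then show ?thesis by (simp add: exp_transform_def[abs_def])
qed

lemma eig_freq_tendsto_1: "(\<lambda>k. eig_freq (int k)) \<longlonglongrightarrow> 1"
  unfolding eig_freq_def eig_scale_def of_int_of_nat_eq by real_asymp

text \<open>Strictness keeps the eigenvalues away from their limit \<i>, as the definition of a
  limit point demands.\<close>

lemma eig_freq_less_1: "eig_freq n < 1"
proof -
  have "\<bar>real_of_int n * pi\<bar> < eig_scale n"
    unfolding eig_scale_def by (rule real_less_rsqrt) simp
  then show ?thesis by (simp add: eig_freq_def divide_less_eq)
qed

text \<open>The identity theorem for an entire function: the zeros accumulate at \<i>, a point of
  the domain of holomorphy.\<close>

lemma exp_transform_eq_0:
  assumes h: "continuous_on {0..T} h"
    and z: "\<And>n. n > N \<Longrightarrow> exp_transform T h (\<i> * complex_of_real (eig_freq n)) = 0"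
  shows "exp_transform T h w = 0"
proof (rule analytic_continuation[OF exp_transform_holomorphic[OF h]])
  let ?U = "(\<lambda>n. \<i> * complex_of_real (eig_freq n)) ` {N<..}"
  show "\<i> islimpt ?U"
    unfolding islimpt_sequential
  proof (intro exI conjI allI)
    \<comment> \<open>The shift by \<open>nat (N + 1)\<close> puts every index above
      \<open>N\<close>, also when \<open>N\<close> is negative.\<close>
    let ?f = "\<lambda>k. \<i> * complex_of_real (eig_freq (int (k + nat (N + 1))))"
    show "?f k \<in> ?U - {\<i>}" for k
    proof -
      have "eig_freq (int (k + nat (N + 1))) \<noteq> 1" using eig_freq_less_1[of "int (k + nat (N + 1))"] by simp
      then show ?thesis by (auto intro!: imageI)
    qed
    have "?f \<longlonglongrightarrow> \<i> * complex_of_real 1"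
      by (intro tendsto_intros LIMSEQ_ignore_initial_segment[OF eig_freq_tendsto_1])
    then show "?f \<longlonglongrightarrow> \<i>" by simp
  qed
qed (use z in auto)

text \<open>The coordinate of the Duhamel formula at time \<open>T\<close> is zero on the left. For
  n \<noteq> 0 the forcing contains the derivative of \<open>h\<close>; moving it onto the
  exponential yields the factor \<i> \<open>eig_freq n\<close>, whose n \<pi> cancels the one in the
  forcing coefficient.\<close>

lemma moment_identity:
  assumes T: "T > 0" and h: "H1_on 0 T h" "h 0 = 0" and X: "H10 u0" "L2 v0"
    and sol: "is_solution T h u0 v0 W"
    and u: "\<forall>x\<in>{0..1}. fst (W T) x + complex_of_real x * h T = 0"
    and v: "AE x in lebesgue_on {0..1}. snd (W T) x = 0"
  shows "ipH (u0, v0) (eigU n) = (if n = 0 then -1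
     else \<i> * complex_of_real (cos (real_of_int n * pi) / (eig_scale n)^2)) *
       exp_transform T h (\<i> * complex_of_real (eig_freq n))"
proof -
  let ?g = "wderiv_on 0 T h" and ?l = "\<i> * complex_of_real (eig_freq n)"
  let ?a = "ipH (u0, v0) (eigU n)"
  have WH: "W T \<in> Hspace" and Weq: "ipH (W T) (eigU n) = semigrp_ip T ((\<lambda>x. u0 x - complex_of_real x * h 0), v0) (eigU n)
      + integral {0..T} (\<lambda>\<tau>. semigrp_ip (T - \<tau>) (forcing T h \<tau>) (eigU n))"
    using sol T eigU_in_Hspace unfolding is_solution_def by auto
  have W10: "H10 (fst (W T))" using WH by (auto simp: Hspace_def)
  \<comment> \<open>At x = 1 the lifted part \<open>W T\<close> vanishes, so the null target
    condition leaves the boundary value \<open>h T\<close>.\<close>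
  have hT: "h T = 0" using bspec[OF u, of 1] H10_wderiv(4)[OF W10] by simp
  have "sine_coeff (fst (W T)) n = (\<integral>x. 0 \<partial>lebesgue_on {0..1::real})"
    unfolding sine_coeff_def by (rule Bochner_Integration.integral_cong) (use u hT in auto)
  moreover have "cosine_coeff (snd (W T)) n = 0" for n
    unfolding cosine_coeff_def by (rule integral_eq_zero_AE) (use v in eventually_elim, simp)
  ultimately have W0: "ipH (W T) (eigU n) = 0"
    using ipH_eigU[OF W10, of "snd (W T)" n] by auto
  have XH: "(u0, v0) \<in> Hspace" using X by (simp add: Hspace_def)
  let ?c = "\<lambda>\<tau>. ipH (forcing T h \<tau>) (eigU n)"
  have "integral {0..T} (\<lambda>\<tau>. semigrp_ip (T - \<tau>) (forcing T h \<tau>) (eigU n))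
     = integral {0..T} (\<lambda>\<tau>. exp (- (?l * complex_of_real T)) * (?c \<tau> * exp (?l * complex_of_real \<tau>)))"
    by (rule integral_cong) (simp add: semigrp_ip_eigU[OF forcing_eigU(1)] algebra_simps flip: exp_add)
  also have "\<dots> = exp (- (?l * complex_of_real T)) * integral {0..T} (\<lambda>\<tau>. ?c \<tau> * exp (?l * complex_of_real \<tau>))"
    by (rule integral_mult_right)
  \<comment> \<open>The lifting \<open>x * h 0\<close> disappears from the initial state since
    \<open>h 0 = 0\<close>; the common exponential factor is nonzero and is cancelled next.\<close>
  finally have "0 = exp (- (?l * complex_of_real T)) * (?a + integral {0..T} (\<lambda>\<tau>. ?c \<tau> * exp (?l * complex_of_real \<tau>)))"
    using Weq W0 h(2) by (simp add: semigrp_ip_eigU[OF XH] algebra_simps)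
  then have main: "?a = - integral {0..T} (\<lambda>\<tau>. ?c \<tau> * exp (?l * complex_of_real \<tau>))"
    by (simp add: add_eq_0_iff2)
  show ?thesis
  proof (cases "n = 0")
    case True
    then show ?thesis using main by (simp add: forcing_eigU(2) exp_transform_def)
  next
    case False
    let ?k = "complex_of_real (cos (real_of_int n * pi)) / complex_of_real (real_of_int n * pi * eig_scale n)"
    have hw: "weak_derivative_on 0 T h ?g" by (rule H1_on_wderiv[OF h(1)])
    have hc: "continuous_on {0..T} h" by (rule weak_derivative_continuous[OF hw])
    have d: "((\<lambda>t. exp (?l * complex_of_real t)) has_vector_derivative ?l * exp (?l * complex_of_real t)) (at t within {0..T})" for t
      by (rule has_vector_derivative_real_field) (auto intro!: derivative_eq_intros)
    have "(\<integral>t. ?g t * exp (?l * complex_of_real t) \<partial>lebesgue_on {0..T}) = - (\<integral>t. h t * (?l * exp (?l * complex_of_real t)) \<partial>lebesgue_on {0..T})"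
      using T by (subst weak_derivative_by_parts[OF _ hw d]) (auto simp: h hT intro!: continuous_intros)
    also have "(\<integral>t. ?g t * exp (?l * complex_of_real t) \<partial>lebesgue_on {0..T}) = integral {0..T} (\<lambda>t. ?g t * exp (?l * complex_of_real t))"
      by (intro lebesgue_integral_eq_integral integrable_mult_continuous weak_derivative_integrable[OF hw] continuous_intros) auto
    also have "(\<integral>t. h t * (?l * exp (?l * complex_of_real t)) \<partial>lebesgue_on {0..T}) = integral {0..T} (\<lambda>t. h t * (?l * exp (?l * complex_of_real t)))"
      by (intro lebesgue_integral_eq_integral continuous_imp_integrable_real continuous_intros hc) auto
    also have "\<dots> = integral {0..T} (\<lambda>t. ?l * (h t * exp (?l * complex_of_real t)))"
      by (rule integral_cong) (simp add: algebra_simps)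
    also have "\<dots> = ?l * exp_transform T h ?l"
      unfolding exp_transform_def by (rule integral_mult_right)
    finally have g: "integral {0..T} (\<lambda>t. ?g t * exp (?l * complex_of_real t)) = - (?l * exp_transform T h ?l)" .
    have "?a = - integral {0..T} (\<lambda>t. ?k * (?g t * exp (?l * complex_of_real t)))"
      using main False by (simp add: forcing_eigU(2) mult.assoc)
    also have "\<dots> = - (?k * integral {0..T} (\<lambda>t. ?g t * exp (?l * complex_of_real t)))"
      by (subst integral_mult_right) (rule refl)
    also have "\<dots> = \<i> * complex_of_real (cos (real_of_int n * pi) / (eig_scale n)^2) * exp_transform T h ?l"
      unfolding g using False by (simp add: eig_freq_def power2_eq_square field_simps)
    finally show ?thesis using False by simp
  qed
qed

section \<open>Orthogonality and finite spans of eigenfunctions\<close>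

lemma trig_orthogonal:
  assumes "\<bar>m\<bar> \<noteq> \<bar>n\<bar>"
  shows "sine_coeff (\<lambda>x. complex_of_real (sin (real_of_int m * pi * x))) n = 0"
    and "cosine_coeff (\<lambda>x. complex_of_real (cos (real_of_int m * pi * x))) n = 0"
proof -
  let ?m = "real_of_int m * pi" and ?n = "real_of_int n * pi"
  have "m^2 \<noteq> n^2" using assms by (metis abs_eq_iff power2_eq_iff)
  then have "(real_of_int m)^2 \<noteq> (real_of_int n)^2" by (metis of_int_eq_iff of_int_power)
  then have D: "?n^2 - ?m^2 \<noteq> 0" by (simp add: power_mult_distrib flip: left_diff_distrib)
  have z: "sin ?m = 0" "sin ?n = 0" by (simp_all add: mult.commute[of _ pi] sin_npi_int)
  \<comment> \<open>\<open>F\<close> and \<open>G\<close> are antiderivatives of the sine and cosine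
    products. Each summand contains a sine that vanishes at both endpoints; distinct absolute values
    of m and n keep the denominator nonzero.\<close>
  define F where "F = (\<lambda>x. (?m * cos (?m * x) * sin (?n * x) - ?n * sin (?m * x) * cos (?n * x)) / (?n^2 - ?m^2))"
  define G where "G = (\<lambda>x. (?n * cos (?m * x) * sin (?n * x) - ?m * sin (?m * x) * cos (?n * x)) / (?n^2 - ?m^2))"
  have F: "(F has_real_derivative sin (?m * x) * sin (?n * x)) (at x within A)" for x A
  proof -
    have "((\<lambda>x. ?m * cos (?m * x) * sin (?n * x) - ?n * sin (?m * x) * cos (?n * x)) has_real_derivative (?n^2 - ?m^2) * (sin (?m * x) * sin (?n * x))) (at x within A)"
      by (auto intro!: derivative_eq_intros simp: algebra_simps power2_eq_square)
    from DERIV_cdivide[OF this, of "?n^2 - ?m^2"] show ?thesis using D by (simp add: F_def)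
  qed
  have G: "(G has_real_derivative cos (?m * x) * cos (?n * x)) (at x within A)" for x A
  proof -
    have "((\<lambda>x. ?n * cos (?m * x) * sin (?n * x) - ?m * sin (?m * x) * cos (?n * x)) has_real_derivative (?n^2 - ?m^2) * (cos (?m * x) * cos (?n * x))) (at x within A)"
      by (auto intro!: derivative_eq_intros simp: algebra_simps power2_eq_square)
    from DERIV_cdivide[OF this, of "?n^2 - ?m^2"] show ?thesis using D by (simp add: G_def)
  qed
  have "(\<integral>x. complex_of_real (sin (?m * x) * sin (?n * x)) \<partial>lebesgue_on {0..1}) = complex_of_real (F 1) - complex_of_real (F 0)"
    by (rule FTC_lebesgue_on)
       (simp, rule has_vector_derivative_of_real, rule F,
        intro continuous_intros)
  then show "sine_coeff (\<lambda>x. complex_of_real (sin (real_of_int m * pi * x))) n = 0"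
    by (simp add: sine_coeff_def F_def z)
  have "(\<integral>x. complex_of_real (cos (?m * x) * cos (?n * x)) \<partial>lebesgue_on {0..1}) = complex_of_real (G 1) - complex_of_real (G 0)"
    by (rule FTC_lebesgue_on)
       (simp, rule has_vector_derivative_of_real, rule G,
        intro continuous_intros)
  then show "cosine_coeff (\<lambda>x. complex_of_real (cos (real_of_int m * pi * x))) n = 0"
    by (simp add: cosine_coeff_def G_def z)
qed

lemma eigU_continuous:
  "continuous_on A (fst (eigU n))" "continuous_on A (snd (eigU n))"
  by (cases "n = 0"; auto simp: eigU_nonzero eigU_zero intro!: continuous_intros)+

text \<open>Absolute values are compared because \<open>eigU n\<close> and \<open>eigU (-n)\<close>
  involve the same sine and cosine up to sign; they cannot be separated component by
  component.\<close>

lemma eigU_orthogonal: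
  assumes "\<bar>m\<bar> \<noteq> \<bar>n\<bar>"
  shows "sine_coeff (fst (eigU m)) n = 0" "cosine_coeff (snd (eigU m)) n = 0"
proof -
  have f: "fst (eigU m) = (\<lambda>x. complex_of_real (1 / eig_scale m) * complex_of_real (sin (real_of_int m * pi * x)))"
    by (cases "m = 0") (simp_all add: eigU_nonzero eigU_zero)
  have s: "snd (eigU m) = (\<lambda>x. (if m = 0 then 1 else \<i>) * complex_of_real (cos (real_of_int m * pi * x)))"
    by (cases "m = 0") (simp_all add: eigU_nonzero eigU_zero)
  show "sine_coeff (fst (eigU m)) n = 0" "cosine_coeff (snd (eigU m)) n = 0"
    using trig_orthogonal[OF assms] unfolding f s sine_coeff_def cosine_coeff_def
    by (simp_all add: mult.assoc)
qed

lemma integral_sum_mult_eq_0: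
  assumes "finite S" and f: "\<And>x. x \<in> {0..1} \<Longrightarrow> f x = (\<Sum>n\<in>S. c n * e n x)"
    and e: "\<And>n. continuous_on {0..1} (e n)" and k: "continuous_on {0..1} k"
    and 0: "\<And>n. n \<in> S \<Longrightarrow> (\<integral>x. e n x * k x \<partial>lebesgue_on {0..1}) = 0"
  shows "(\<integral>x. f x * k x \<partial>lebesgue_on {0..1::real}) = (0::complex)"
proof -
  have "(\<integral>x. f x * k x \<partial>lebesgue_on {0..1}) = (\<integral>x. (\<Sum>n\<in>S. c n * (e n x * k x)) \<partial>lebesgue_on {0..1})"
    by (intro Bochner_Integration.integral_cong) (auto simp: f sum_distrib_right mult.assoc)
  also have "\<dots> = (\<Sum>n\<in>S. \<integral>x. c n * (e n x * k x) \<partial>lebesgue_on {0..1})"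
    by (intro Bochner_Integration.integral_sum continuous_imp_integrable_real continuous_intros e k)
  also have "\<dots> = 0" using 0 by simp
  finally show ?thesis .
qed

text \<open>Expanding the conjugated factor of |f|^2 in the family shows that its integral is zero;
  continuity turns this into pointwise vanishing.\<close>

lemma span_orthogonal_imp_zero:
  assumes S: "finite S" and f: "\<And>x. x \<in> {0..1} \<Longrightarrow> f x = (\<Sum>n\<in>S. c n * e n x)"
    and e: "\<And>n. continuous_on {0..1} (e n)"
    and 0: "\<And>n. n \<in> S \<Longrightarrow> ipL2 f (e n) = 0"
    and x: "x \<in> {0..1}"
  shows "f x = 0"
proof -
  have fc: "continuous_on {0..1} f"
    using f by (subst continuous_on_cong[OF refl, where g="\<lambda>x. \<Sum>n\<in>S. c n * e n x"]) (auto intro!: continuous_intros e)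
  have "(\<integral>x. cnj (f x) * f x \<partial>lebesgue_on {0..1}) = 0"
  proof (rule integral_sum_mult_eq_0[OF S, where e="\<lambda>n x. cnj (e n x)" and c="\<lambda>n. cnj (c n)"])
    show "(\<integral>x. cnj (e n x) * f x \<partial>lebesgue_on {0..1}) = 0" if "n \<in> S" for n
      using 0[OF that] by (simp add: ipL2_def mult.commute)
  qed (auto simp: f intro!: continuous_intros e fc)
  also have "(\<integral>x. cnj (f x) * f x \<partial>lebesgue_on {0..1}) = (\<integral>x. complex_of_real ((cmod (f x))^2) \<partial>lebesgue_on {0..1})"
    by (simp only: complex_norm_square mult.commute)
  finally have "(\<integral>x. (cmod (f x))^2 \<partial>lebesgue_on {0..1}) = 0"
    by (simp only: integral_complex_of_real of_real_eq_0_iff)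
  then have "\<forall>x\<in>{0..1}. (cmod (f x))^2 = 0"
    by (subst (asm) integralL_eq_0_iff) (auto intro!: continuous_intros fc)
  then show ?thesis using x by simp
qed

theorem theorem1p3:
  fixes T :: real and u0 v0 :: "real \<Rightarrow> complex" and S :: "int set" and c :: "int \<Rightarrow> complex"
  assumes "T > 0"
    and "finite S"
    and "\<forall>x\<in>{0..1}. u0 x = (\<Sum>n\<in>S. c n * fst (eigU n) x) \<and> v0 x = (\<Sum>n\<in>S. c n * snd (eigU n) x)"
    and "\<not> ((\<forall>x\<in>{0..1}. u0 x = 0) \<and> (AE x in lebesgue_on {0..1}. v0 x = 0))"
  shows "\<not> (\<exists>h W. H1_on 0 T h \<and> h 0 = 0 \<and> is_solution T h u0 v0 W \<and>
            (\<forall>x\<in>{0..1}. fst (W T) x + complex_of_real x * h T = 0) \<and>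
            (AE x in lebesgue_on {0..1}. snd (W T) x = 0))"
proof
  assume "\<exists>h W. H1_on 0 T h \<and> h 0 = 0 \<and> is_solution T h u0 v0 W \<and>
            (\<forall>x\<in>{0..1}. fst (W T) x + complex_of_real x * h T = 0) \<and>
            (AE x in lebesgue_on {0..1}. snd (W T) x = 0)"
  then obtain h W where h: "H1_on 0 T h" "h 0 = 0" and sol: "is_solution T h u0 v0 W"
      "\<forall>x\<in>{0..1}. fst (W T) x + complex_of_real x * h T = 0" "AE x in lebesgue_on {0..1}. snd (W T) x = 0"
    by blast
  have u0: "u0 x = (\<Sum>n\<in>S. c n * fst (eigU n) x)" and v0: "v0 x = (\<Sum>n\<in>S. c n * snd (eigU n) x)"
    if "x \<in> {0..1}" for x
    using assms(3) that by auto
  have uH: "H10 u0"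
    by (rule H10_cong[OF H10_sum[OF assms(2) fst_eigU(1)]]) (simp add: u0)
  have "continuous_on {0..1} v0"
    using v0 by (subst continuous_on_cong[OF refl, where g="\<lambda>x. \<Sum>n\<in>S. c n * snd (eigU n) x"])
      (auto intro!: continuous_intros eigU_continuous)
  then have vL: "L2 v0" by (rule L2_on_continuous)
  note moment = moment_identity[OF assms(1) h uH vL sol]
  have hc: "continuous_on {0..T} h"
    by (rule weak_derivative_continuous[OF H1_on_wderiv(2)[OF h(1)]])
  \<comment> \<open>A bound for all |m| with m in \<open>S\<close> that also makes sense for empty
    \<open>S\<close>; any n > \<open>N\<close> is positive and differs from every m and -m.\<close>
  define N where "N = (\<Sum>m\<in>S. \<bar>m\<bar>)"
  have E: "exp_transform T h w = 0" for w
  proof (rule exp_transform_eq_0[OF hc])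
    fix n assume n: "n > N"
    have ne: "\<bar>m\<bar> \<noteq> \<bar>n\<bar>" if "m \<in> S" for m
    proof -
      have "\<bar>m\<bar> \<le> N" unfolding N_def using that assms(2) by (intro member_le_sum) auto
      then show ?thesis using n by auto
    qed
    have "N \<ge> 0" by (auto simp: N_def intro: sum_nonneg)
    then have n0: "n \<noteq> 0" using n by auto
    have "sine_coeff u0 n = 0" unfolding sine_coeff_def
      by (rule integral_sum_mult_eq_0[OF assms(2) u0 eigU_continuous(1)])
         (use eigU_orthogonal(1)[OF ne] in \<open>auto simp: sine_coeff_def intro!: continuous_intros\<close>)
    moreover have "cosine_coeff v0 n = 0" unfolding cosine_coeff_def
      by (rule integral_sum_mult_eq_0[OF assms(2) v0 eigU_continuous(2)])
         (use eigU_orthogonal(2)[OF ne] in \<open>auto simp: cosine_coeff_def intro!: continuous_intros\<close>)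
    ultimately have "ipH (u0, v0) (eigU n) = 0" by (simp add: ipH_eigU[OF uH] n0)
    \<comment> \<open>The factor in front of the transform in the moment identity is therefore
      nonzero and can be divided out.\<close>
    moreover have "cos (real_of_int n * pi) \<noteq> 0"
      using sin_cos_squared_add[of "real_of_int n * pi"] sin_npi_int[of n] by (auto simp: mult.commute)
    ultimately show "exp_transform T h (\<i> * complex_of_real (eig_freq n)) = 0"
      using moment[of n] n0 by simp
  qed
  \<comment> \<open>With the transform identically zero, the moment identity returns to all n, in
    particular to the indices in \<open>S\<close>.\<close>
  have a0: "ipH (u0, v0) (eigU n) = 0" for n
    using moment[of n] E by simp
  \<comment> \<open>A single coordinate mixes both components. The sine coefficient is odd in n and
    the cosine coefficient even, so the equations for n and -n separate them.\<close>
  have co: "sine_coeff u0 n = 0 \<and> cosine_coeff v0 n = 0" for n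
  proof (cases "n = 0")
    case True
    then show ?thesis using a0[of 0] by (simp add: ipH_eigU[OF uH] sine_coeff_def)
  next
    case False
    have neg: "sine_coeff u0 (-n) = - sine_coeff u0 n" "cosine_coeff v0 (-n) = cosine_coeff v0 n"
      "eig_scale (-n) = eig_scale n"
      by (simp_all add: sine_coeff_def cosine_coeff_def eig_scale_def)
    have 1: "complex_of_real (eig_scale n) * sine_coeff u0 n - \<i> * cosine_coeff v0 n = 0"
      using a0[of n] False by (simp add: ipH_eigU[OF uH])
    have 2: "- (complex_of_real (eig_scale n) * sine_coeff u0 n) - \<i> * cosine_coeff v0 n = 0"
      using a0[of "-n"] False by (simp add: ipH_eigU[OF uH] neg)
    have "2 * (\<i> * cosine_coeff v0 n) = 0" using 1 2 by algebra
    then have "cosine_coeff v0 n = 0" by simp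
    then show ?thesis using 1 by simp
  qed
  have "u0 x = 0" if "x \<in> {0..1}" for x
  proof (rule span_orthogonal_imp_zero[OF assms(2) u0 eigU_continuous(1) _ that])
    fix n
    show "ipL2 u0 (fst (eigU n)) = 0"
    proof (cases "n = 0")
      case False
      have "ipL2 u0 (fst (eigU n)) = (\<integral>x. complex_of_real (1 / eig_scale n) * (u0 x * complex_of_real (sin (real_of_int n * pi * x))) \<partial>lebesgue_on {0..1})"
        by (simp add: ipL2_def eigU_nonzero[OF False])
      also have "\<dots> = 0" using co[of n] unfolding sine_coeff_def by (simp only: integral_mult_right_zero) simp
      finally show ?thesis .
    qed (simp add: ipL2_def eigU_zero)
  qed
  moreover have "v0 x = 0" if "x \<in> {0..1}" for x
  proof (rule span_orthogonal_imp_zero[OF assms(2) v0 eigU_continuous(2) _ that])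
    show "ipL2 v0 (snd (eigU n)) = 0" for n by (simp add: ipL2_snd_eigU co)
  qed
  ultimately show False using assms(4) by (auto intro!: AE_I2)
qed

end
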